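(* Let $p\in\{1,2\}$ and let $h:\mathbb{R}^m\to\mathbb{R}$ be either $h(z)=\|z\|_1$ (L1 problem) or $h(z)=\max_{i=1,\ldots,m}z_i$ (Minimax problem). Take $c_{2,1}(n)=c_{2,2}(n)=1$, $c_{1,2}(m)=\sqrt m$, $c_{2,2}(m)=1$, and the Lipschitz constants $L_{h,1}=1$, $L_{h,2}=\sqrt m$ in the L1 case, and $L_{h,1}=L_{h,2}=1$ in the Minimax case. Then the number of evaluations of $F$ that the algorithm TRFD (described in the context) needs to find an $\epsilon$-approximate stationary point is $\mathcal{O}(n\epsilon^{-2})$, in the following sense. For all $m\ge1$, $L_J>0$, $\sigma>0$, $\alpha\in(0,1)$, $\theta\in(0,1]$, $\Delta_0>0$ and $M\ge0$ there is a constant $C$, depending only on these quantities (and not on $n$ or $\epsilon$), such that the following holds for all $n\ge1$ and $\epsilon\in(0,1]$: if $\Omega\subset\mathbb{R}^n$ is nonempty, closed and convex, $F:\mathbb{R}^n\to\mathbb{R}^m$ is differentiable with $\|J_F(x)-J_F(y)\|_2\le L_J\|x-y\|_2$ for all $x,y\in\mathbb{R}^n$, $f=h\circ F$ satisfies $f(x)\ge f_{low}$ for all $x\in\mathbb{R}^n$, $x_0\in\Omega$ with $f(x_0)-f_{low}\le M$, and TRFD is run with this $p$ and these parameters (with any admissible $\Delta_*$), then TRFD generates a point $x_k$ with $\psi_{p,\Delta_*}(x_k)\le\epsilon$ after at most $C\,n\,\epsilon^{-2}$ evaluations of $F$.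
   Context: Notation: $\|\cdot\|_p$ is the $p$-norm (for matrices $\|\cdot\|_2$ is the spectral norm), $J_F$ the Jacobian of $F$, $f=h\circ F$, $\Omega-\{x\}=\{s\in\mathbb{R}^n:x+s\in\Omega\}$, $[A]_j$ the $j$-th column of $A$, $e_j$ the $j$-th canonical vector. The constants $c_{2,p}(n),c_{p,2}(m)$ satisfy $\|x\|_2\le c_{2,p}(n)\|x\|_p$ on $\mathbb{R}^n$ and $\|z\|_p\le c_{p,2}(m)\|z\|_2$ on $\mathbb{R}^m$; $L_{h,p}$ satisfies $|h(z)-h(w)|\le L_{h,p}\|z-w\|_p$. For $r>0$, $x\in\Omega$, $A\in\mathbb{R}^{m\times n}$, $$\psi_{p,r}(x)=\tfrac1r\Big(h(F(x))-\min_{s\in\Omega-\{x\},\,\|s\|_p\le r}h(F(x)+J_F(x)s)\Big),\qquad \eta_{p,r}(x;A)=\tfrac1r\Big(h(F(x))-\min_{s\in\Omega-\{x\},\,\|s\|_p\le r}h(F(x)+As)\Big).$$ Algorithm TRFD. Step 0: given $x_0\in\Omega$, $\epsilon>0$, $\sigma>0$, $\alpha\in(0,1)$, $\theta\in(0,1]$ and $L_{h,p}$, set $\tau_0=\epsilon/(L_{h,p}\sigma c_{p,2}(m)c_{2,p}(n)\sqrt n)$, choose $\Delta_0,\Delta_*$ with $\tau_0\sqrt n\le\Delta_0\le\Delta_*$, set $k:=0$. Step 1: construct $A_k\in\mathbb{R}^{m\times n}$ with $[A_k]_j=(F(x_k+\tau_ke_j)-F(x_k))/\tau_k$, $j=1,\ldots,n$,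 and compute $\eta_{p,\Delta_*}(x_k;A_k)$. Step 2: if $\eta_{p,\Delta_*}(x_k;A_k)\ge\epsilon/2$ go to Step 3; otherwise set $x_{k+1}=x_k$, $\Delta_{k+1}=\Delta_k$, $\tau_{k+1}=\frac12\tau_k$, $k:=k+1$ and go to Step 1. Step 3: let $d_k^*$ minimize $h(F(x_k)+A_kd)$ subject to $\|d\|_p\le\Delta_k$, $x_k+d\in\Omega$; compute any $d_k$ with $\|d_k\|_p\le\Delta_k$, $x_k+d_k\in\Omega$ and $h(F(x_k))-h(F(x_k)+A_kd_k)\ge\theta[h(F(x_k))-h(F(x_k)+A_kd_k^* )]$. Step 4: compute $\rho_k=\frac{h(F(x_k))-h(F(x_k+d_k))}{h(F(x_k))-h(F(x_k)+A_kd_k)}$; if $\rho_k\ge\alpha$, set $x_{k+1}=x_k+d_k$, $\Delta_{k+1}=\min\{2\Delta_k,\Delta_*\}$, $\tau_{k+1}=\tau_k$, $k:=k+1$ and go to Step 1. Step 5: (if $\rho_k<\alpha$) set $x_{k+1}=x_k$, $\Delta_{k+1}=\frac12\Delta_k$; if $\tau_k\sqrt n\le\Delta_{k+1}$, set $\tau_{k+1}=\tau_k$, $A_{k+1}=A_k$, $k:=k+1$ and go to Step 3; otherwise set $\tau_{k+1}=\frac12\tau_k$, $k:=k+1$ and go to Step 1. (No stopping test: the algorithm generates infinite sequences.) "Admissible" means the Step 0 requirement $\tau_0\sqrt n\le\Delta_0\le\Delta_*$ holds. Counting of evaluations: $F(x_0)$ is evaluated once at the start; constructing $A_k$ at Step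 1 costs $n$ evaluations $F(x_k+\tau_ke_j)$; Step 4 costs one evaluation $F(x_k+d_k)$; already computed values are stored and reused. The evaluations counted are those of all iterations preceding the first $k$ with $\psi_{p,\Delta_*}(x_k)\le\epsilon$. *)

theory Defs
  imports "HOL-Analysis.Analysis" "Jordan_Normal_Form.Matrix"
begin

unbundle no vec_syntax
hide_type (open) Finite_Cartesian_Product.vec

text \<open>
  The dimension \<open>n\<close> is quantified inside the complexity statement, so it cannot be a type:
  \<open>\<real>\<^sup>n\<close> is the set \<^term>\<open>carrier_vec n :: real vec set\<close> and the \<open>m \<times> n\<close> matrices are
  \<^term>\<open>carrier_mat m n :: real mat set\<close>. Coordinates are numbered from \<open>0\<close>.
\<close>

definition pnorm :: "nat \<Rightarrow> real vec \<Rightarrow> real" where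
  "pnorm p x = root p (\<Sum>i<dim_vec x. \<bar>x $ i\<bar> ^ p)"

definition spectral_norm :: "real mat \<Rightarrow> real" where
  "spectral_norm A = Sup {pnorm 2 (A *\<^sub>v x) | x. x \<in> carrier_vec (dim_col A) \<and> pnorm 2 x \<le> 1}"

definition max_entry :: "real vec \<Rightarrow> real" where
  "max_entry z = Max {z $ i | i. i < dim_vec z}"

text \<open>
  The Euclidean distance on \<open>\<real>\<^sup>n\<close>. It is written with an index set instead of
  \<^term>\<open>pnorm 2 (x - y)\<close> because \<^locale>\<open>Metric_space\<close> asks for symmetry also outside the carrier,
  where \<^term>\<open>x - y\<close> takes its dimension from \<^term>\<open>y\<close>.
\<close>

definition vec_dist :: "nat \<Rightarrow> real vec \<Rightarrow> real vec \<Rightarrow> real" where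
  "vec_dist n x y = L2_set (\<lambda>i. x $ i - y $ i) {..<n}"

lemma vec_dist_eq_pnorm: "y \<in> carrier_vec n \<Longrightarrow> vec_dist n x y = pnorm 2 (x - y)"
  by (simp add: vec_dist_def pnorm_def L2_set_def sqrt_def)

lemma Metric_space_vec_dist: "Metric_space (carrier_vec n) (vec_dist n)"
proof
  show "0 \<le> vec_dist n x y" for x y
    by (simp add: vec_dist_def)
  show "vec_dist n x y = vec_dist n y x" for x y
    by (simp add: vec_dist_def L2_set_def power2_commute)
  show "(vec_dist n x y = 0) = (x = y)" if "x \<in> carrier_vec n" "y \<in> carrier_vec n" for x y
    using that by (auto simp: vec_dist_def L2_set_eq_0_iff)
  show "vec_dist n x z \<le> vec_dist n x y + vec_dist n y z" for x y z
    using L2_set_triangle_ineq[of "\<lambda>i. x $ i - y $ i" "\<lambda>i. y $ i - z $ i" "{..<n}"]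
    by (simp add: vec_dist_def)
qed

definition closed_vec_set :: "nat \<Rightarrow> real vec set \<Rightarrow> bool" where
  "closed_vec_set n \<Omega> \<longleftrightarrow> closedin (Metric_space.mtopology (carrier_vec n) (vec_dist n)) \<Omega>"

definition convex_vec_set :: "real vec set \<Rightarrow> bool" where
  "convex_vec_set \<Omega> \<longleftrightarrow>
     (\<forall>x\<in>\<Omega>. \<forall>y\<in>\<Omega>. \<forall>u\<ge>0. \<forall>v\<ge>0. u + v = 1 \<longrightarrow> u \<cdot>\<^sub>v x + v \<cdot>\<^sub>v y \<in> \<Omega>)"

definition differentiable_at_vec ::
  "nat \<Rightarrow> nat \<Rightarrow> (real vec \<Rightarrow> real vec) \<Rightarrow> real vec \<Rightarrow> bool" where
  "differentiable_at_vec n m F x \<longleftrightarrow>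
     (\<exists>A\<in>carrier_mat m n. \<forall>e>0. \<exists>\<delta>>0. \<forall>s\<in>carrier_vec n. pnorm 2 s < \<delta> \<longrightarrow>
        pnorm 2 (F (x + s) - F x - A *\<^sub>v s) \<le> e * pnorm 2 s)"

definition jacobian_mat :: "nat \<Rightarrow> nat \<Rightarrow> (real vec \<Rightarrow> real vec) \<Rightarrow> real vec \<Rightarrow> real mat" where
  "jacobian_mat n m F x = mat m n (\<lambda>(i, j). deriv (\<lambda>t. F (x + t \<cdot>\<^sub>v unit_vec n j) $ i) 0)"

definition feasible_steps :: "nat \<Rightarrow> nat \<Rightarrow> real vec set \<Rightarrow> real \<Rightarrow> real vec \<Rightarrow> real vec set" where
  "feasible_steps n p \<Omega> r x = {s \<in> carrier_vec n. x + s \<in> \<Omega> \<and> pnorm p s \<le> r}"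

text \<open>
  The minimum is literally a \<open>LEAST\<close> over the reals; it is attained for closed \<open>\<Omega>\<close> and \<open>x \<in> \<Omega>\<close>,
  the feasible steps then being a nonempty compact set.
\<close>

definition eta :: "nat \<Rightarrow> nat \<Rightarrow> (real vec \<Rightarrow> real) \<Rightarrow> (real vec \<Rightarrow> real vec) \<Rightarrow> real vec set \<Rightarrow>
    real \<Rightarrow> real vec \<Rightarrow> real mat \<Rightarrow> real" where
  "eta n p h F \<Omega> r x A =
     1 / r * (h (F x) - (LEAST v. \<exists>s\<in>feasible_steps n p \<Omega> r x. v = h (F x + A *\<^sub>v s)))"

definition psi :: "nat \<Rightarrow> nat \<Rightarrow> nat \<Rightarrow> (real vec \<Rightarrow> real) \<Rightarrow> (real vec \<Rightarrow> real vec) \<Rightarrow> real vec set \<Rightarrow>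
    real \<Rightarrow> real vec \<Rightarrow> real" where
  "psi n m p h F \<Omega> r x = eta n p h F \<Omega> r x (jacobian_mat n m F x)"

text \<open>
  The data of iteration \<open>k\<close>: \<open>x\<^sub>k\<close>, \<open>\<Delta>\<^sub>k\<close>, \<open>\<tau>\<^sub>k\<close>, \<open>A\<^sub>k\<close>, \<open>d\<^sub>k\<close>, and whether the iteration begins at
  Step 1 (otherwise it begins at Step 3 with the matrix of the previous iteration). The field
  \<open>trial\<close> is unconstrained in iterations that do not reach Step 3.
\<close>

record trfd_state =
  iterate :: "real vec"
  radius :: real
  fd_step :: real
  model :: "real mat"
  trial :: "real vec"
  at_step1 :: bool

definition finite_difference_model ::
  "nat \<Rightarrow> nat \<Rightarrow> (real vec \<Rightarrow> real vec) \<Rightarrow> real vec \<Rightarrow> real \<Rightarrow> real mat \<Rightarrow> bool" where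
  "finite_difference_model n m F x \<tau> A \<longleftrightarrow> A \<in> carrier_mat m n \<and>
     (\<forall>j<n. col A j = (1 / \<tau>) \<cdot>\<^sub>v (F (x + \<tau> \<cdot>\<^sub>v unit_vec n j) - F x))"

definition reaches_step3 :: "nat \<Rightarrow> nat \<Rightarrow> (real vec \<Rightarrow> real) \<Rightarrow> (real vec \<Rightarrow> real vec) \<Rightarrow> real vec set \<Rightarrow>
    real \<Rightarrow> real \<Rightarrow> trfd_state \<Rightarrow> bool" where
  "reaches_step3 n p h F \<Omega> \<epsilon> \<Delta>max S \<longleftrightarrow>
     (at_step1 S \<longrightarrow> eta n p h F \<Omega> \<Delta>max (iterate S) (model S) \<ge> \<epsilon> / 2)"

definition acceptable_trial :: "nat \<Rightarrow> nat \<Rightarrow> (real vec \<Rightarrow> real) \<Rightarrow> (real vec \<Rightarrow> real vec) \<Rightarrow>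
    real vec set \<Rightarrow> real \<Rightarrow> real \<Rightarrow> real vec \<Rightarrow> real mat \<Rightarrow> real vec \<Rightarrow> bool" where
  "acceptable_trial n p h F \<Omega> \<theta> r x A d \<longleftrightarrow> d \<in> feasible_steps n p \<Omega> r x \<and>
     (\<exists>d'\<in>feasible_steps n p \<Omega> r x.
        (\<forall>s\<in>feasible_steps n p \<Omega> r x. h (F x + A *\<^sub>v d') \<le> h (F x + A *\<^sub>v s)) \<and>
        h (F x) - h (F x + A *\<^sub>v d) \<ge> \<theta> * (h (F x) - h (F x + A *\<^sub>v d')))"

definition reduction_ratio :: "(real vec \<Rightarrow> real) \<Rightarrow> (real vec \<Rightarrow> real vec) \<Rightarrow> trfd_state \<Rightarrow> real" where
  "reduction_ratio h F S =
     (h (F (iterate S)) - h (F (iterate S + trial S))) /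
     (h (F (iterate S)) - h (F (iterate S) + model S *\<^sub>v trial S))"

text \<open>One iteration: \<open>S\<close> and \<open>T\<close> are the data of iterations \<open>k\<close> and \<open>k + 1\<close>.\<close>

definition trfd_iteration :: "nat \<Rightarrow> nat \<Rightarrow> nat \<Rightarrow> (real vec \<Rightarrow> real) \<Rightarrow> (real vec \<Rightarrow> real vec) \<Rightarrow>
    real vec set \<Rightarrow> real \<Rightarrow> real \<Rightarrow> real \<Rightarrow> real \<Rightarrow> trfd_state \<Rightarrow> trfd_state \<Rightarrow> bool" where
  "trfd_iteration n m p h F \<Omega> \<epsilon> \<alpha> \<theta> \<Delta>max S T \<longleftrightarrow>
     (at_step1 S \<longrightarrow> finite_difference_model n m F (iterate S) (fd_step S) (model S)) \<and>
     (if \<not> reaches_step3 n p h F \<Omega> \<epsilon> \<Delta>max S then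
        iterate T = iterate S \<and> radius T = radius S \<and> fd_step T = fd_step S / 2 \<and> at_step1 T
      else
        acceptable_trial n p h F \<Omega> \<theta> (radius S) (iterate S) (model S) (trial S) \<and>
        (if reduction_ratio h F S \<ge> \<alpha> then
           iterate T = iterate S + trial S \<and> radius T = min (2 * radius S) \<Delta>max \<and>
           fd_step T = fd_step S \<and> at_step1 T
         else
           iterate T = iterate S \<and> radius T = radius S / 2 \<and>
           (if fd_step S * sqrt n \<le> radius T then
              fd_step T = fd_step S \<and> model T = model S \<and> \<not> at_step1 T
            else
              fd_step T = fd_step S / 2 \<and> at_step1 T)))"

definition tau_init :: "nat \<Rightarrow> real \<Rightarrow> real \<Rightarrow> real \<Rightarrow> real \<Rightarrow> real \<Rightarrow> real" where
  "tau_init n Lh cp2 c2p \<sigma> \<epsilon> = \<epsilon> / (Lh * \<sigma> * cp2 * c2p * sqrt n)"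

definition trfd_run :: "nat \<Rightarrow> nat \<Rightarrow> nat \<Rightarrow> (real vec \<Rightarrow> real) \<Rightarrow> (real vec \<Rightarrow> real vec) \<Rightarrow>
    real vec set \<Rightarrow> real vec \<Rightarrow> real \<Rightarrow> real \<Rightarrow> real \<Rightarrow> real \<Rightarrow> real \<Rightarrow> real \<Rightarrow> (nat \<Rightarrow> trfd_state) \<Rightarrow> bool" where
  "trfd_run n m p h F \<Omega> x\<^sub>0 \<epsilon> \<alpha> \<theta> \<tau>\<^sub>0 \<Delta>\<^sub>0 \<Delta>max S \<longleftrightarrow>
     \<tau>\<^sub>0 * sqrt n \<le> \<Delta>\<^sub>0 \<and> \<Delta>\<^sub>0 \<le> \<Delta>max \<and>
     iterate (S 0) = x\<^sub>0 \<and> radius (S 0) = \<Delta>\<^sub>0 \<and> fd_step (S 0) = \<tau>\<^sub>0 \<and> at_step1 (S 0) \<and>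
     (\<forall>k. trfd_iteration n m p h F \<Omega> \<epsilon> \<alpha> \<theta> \<Delta>max (S k) (S (Suc k)))"

text \<open>
  Evaluations of \<open>F\<close> in the iterations before iteration \<open>k\<close>: one for \<open>F x\<^sub>0\<close>, \<open>n\<close> whenever Step 1 is
  executed, and one whenever Step 4 is executed.
\<close>

definition evaluations :: "nat \<Rightarrow> nat \<Rightarrow> (real vec \<Rightarrow> real) \<Rightarrow> (real vec \<Rightarrow> real vec) \<Rightarrow> real vec set \<Rightarrow>
    real \<Rightarrow> real \<Rightarrow> (nat \<Rightarrow> trfd_state) \<Rightarrow> nat \<Rightarrow> nat" where
  "evaluations n p h F \<Omega> \<epsilon> \<Delta>max S k =
     1 + (\<Sum>j<k. (if at_step1 (S j) then n else 0) +
                 (if reaches_step3 n p h F \<Omega> \<epsilon> \<Delta>max (S j) then 1 else 0))"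

end

theory Submission
  imports Defs
begin

text \<open>
  Convexity of \<open>h\<close> and the finite-difference error \<open>\<parallel>A\<^sub>k - J\<^sub>F(x\<^sub>k)\<parallel>\<^sub>2 \<le> L\<^sub>J \<tau>\<^sub>k \<surd>n \<le> L\<^sub>J \<Delta>\<^sub>k\<close> show that a
  trial step is accepted once \<open>\<Delta>\<^sub>k\<close> is below a fixed multiple of \<open>\<epsilon>\<close>, so the radii stay above
  \<open>\<kappa> \<epsilon>\<close> with \<open>\<kappa>\<close> independent of \<open>n\<close>, and every successful iteration lowers \<open>f\<close> by a multiple of \<open>\<epsilon>\<^sup>2\<close>.
  A potential built from \<open>f(x\<^sub>k)\<close>, \<open>log \<Delta>\<^sub>k\<close> and \<open>log \<tau>\<^sub>k\<close> drops by at least \<open>1\<close> in every iteration at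
  a nonstationary point and starts at \<open>O(\<epsilon>\<^sup>-\<^sup>2)\<close>; an iteration costs at most \<open>n + 1\<close> evaluations.
\<close>

section \<open>Norms of vectors and matrices\<close>

lemma pnorm_1_eq: "pnorm 1 x = (\<Sum>i<dim_vec x. \<bar>x $ i\<bar>)"
  by (simp add: pnorm_def)

lemma pnorm_2_eq: "pnorm 2 x = L2_set (\<lambda>i. x $ i) {..<dim_vec x}"
  by (simp add: pnorm_def L2_set_def sqrt_def)

lemma pnorm_nonneg [simp]: "0 \<le> pnorm p x"
  by (simp add: pnorm_def sum_nonneg real_root_ge_zero)

lemma pnorm_2_square: "(pnorm 2 x)\<^sup>2 = (\<Sum>i<dim_vec x. x $ i * x $ i)"
  by (simp add: pnorm_2_eq L2_set_def sum_nonneg power2_eq_square)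

lemma pnorm_smult: "p > 0 \<Longrightarrow> pnorm p (c \<cdot>\<^sub>v x) = \<bar>c\<bar> * pnorm p x"
  by (simp add: pnorm_def abs_mult power_mult_distrib real_root_mult real_root_power_cancel
      flip: sum_distrib_left)

lemma abs_index_le_pnorm_2: "i < dim_vec x \<Longrightarrow> \<bar>x $ i\<bar> \<le> pnorm 2 x"
  using member_le_L2_set[of "{..<dim_vec x}" i "\<lambda>i. \<bar>x $ i\<bar>"]
  by (simp add: pnorm_2_eq L2_set_def)

lemma pnorm_2_unit_vec:
  assumes "j < n"
  shows "pnorm 2 (unit_vec n j) = 1"
proof -
  have "(pnorm 2 (unit_vec n j))\<^sup>2 = (\<Sum>i<n. if i = j then 1 else 0)"
    unfolding pnorm_2_square by (simp add: unit_vec_def if_distrib cong: if_cong)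
  then have "(pnorm 2 (unit_vec n j))\<^sup>2 = 1"
    using assms by simp
  then show ?thesis
    using pnorm_nonneg[of 2 "unit_vec n j"] by (auto simp: power2_eq_1_iff)
qed

lemma pnorm_2_le_pnorm_1: "pnorm 2 x \<le> pnorm 1 x"
  unfolding pnorm_1_eq pnorm_2_eq by (rule L2_set_le_sum_abs)

lemma pnorm_1_le_pnorm_2: "pnorm 1 x \<le> sqrt (dim_vec x) * pnorm 2 x"
  using L2_set_mult_ineq[of "\<lambda>_. 1" "\<lambda>i. x $ i" "{..<dim_vec x}"]
  by (simp add: pnorm_1_eq pnorm_2_eq L2_set_constant del: One_nat_def)

lemma pnorm_2_triangle: "dim_vec x = dim_vec y \<Longrightarrow> pnorm 2 (x + y) \<le> pnorm 2 x + pnorm 2 y"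
  using L2_set_triangle_ineq[of "\<lambda>i. x $ i" "\<lambda>i. y $ i" "{..<dim_vec y}"]
  by (simp add: pnorm_2_eq L2_set_def)

lemma pnorm_1_reverse_triangle:
  assumes "dim_vec x = dim_vec y"
  shows "\<bar>pnorm 1 x - pnorm 1 y\<bar> \<le> pnorm 1 (x - y)"
proof -
  have "\<bar>pnorm 1 x - pnorm 1 y\<bar> = \<bar>\<Sum>i<dim_vec y. \<bar>x $ i\<bar> - \<bar>y $ i\<bar>\<bar>"
    using assms by (simp add: pnorm_1_eq sum_subtractf del: One_nat_def)
  also have "\<dots> \<le> (\<Sum>i<dim_vec y. \<bar>x $ i - y $ i\<bar>)"
    by (rule order.trans[OF sum_abs]) (intro sum_mono abs_triangle_ineq3)
  also have "\<dots> = pnorm 1 (x - y)"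
    by (simp add: pnorm_1_eq del: One_nat_def)
  finally show ?thesis .
qed

section \<open>Matrix norms and matrix-vector products\<close>

lemma mult_mat_vec_index_sum:
  assumes "A \<in> carrier_mat m n" "x \<in> carrier_vec n" "i < m"
  shows "(A *\<^sub>v x) $ i = (\<Sum>j<n. A $$ (i, j) * x $ j)"
  using assms by (auto simp: scalar_prod_def atLeast0LessThan intro!: sum.cong)

text \<open>An explicit upper bound for the operator norm. Grouping the squares by rows suits
  Cauchy-Schwarz, applied to one entry of the product at a time; regrouped by columns, they suit
  finite differences, where each column has its own error.\<close>

definition frobenius_norm :: "real mat \<Rightarrow> real" where
  "frobenius_norm A = L2_set (\<lambda>i. L2_set (\<lambda>j. A $$ (i, j)) {..<dim_col A}) {..<dim_row A}"

lemma frobenius_norm_nonneg [simp]: "0 \<le> frobenius_norm A"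
  by (simp add: frobenius_norm_def)

lemma pnorm_2_mult_mat_vec_le_frobenius:
  assumes A: "A \<in> carrier_mat m n" and x: "x \<in> carrier_vec n"
  shows "pnorm 2 (A *\<^sub>v x) \<le> frobenius_norm A * pnorm 2 x"
proof -
  let ?r = "\<lambda>i. L2_set (\<lambda>j. A $$ (i, j)) {..<n}"
  have dims: "dim_row A = m" "dim_col A = n" "dim_vec x = n" using assms by auto
  have row: "\<bar>(A *\<^sub>v x) $ i\<bar> \<le> ?r i * pnorm 2 x" if "i < m" for i
  proof -
    have "\<bar>(A *\<^sub>v x) $ i\<bar> \<le> (\<Sum>j<n. \<bar>A $$ (i, j)\<bar> * \<bar>x $ j\<bar>)"
      unfolding mult_mat_vec_index_sum[OF A x that]
      by (rule order.trans[OF sum_abs]) (simp add: abs_mult)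
    also have "\<dots> \<le> ?r i * L2_set (\<lambda>j. x $ j) {..<n}"
      by (rule L2_set_mult_ineq)
    finally show ?thesis by (simp add: pnorm_2_eq dims)
  qed
  have "pnorm 2 (A *\<^sub>v x) = L2_set (\<lambda>i. \<bar>(A *\<^sub>v x) $ i\<bar>) {..<m}"
    by (simp add: pnorm_2_eq L2_set_def dims)
  also have "\<dots> \<le> L2_set (\<lambda>i. ?r i * pnorm 2 x) {..<m}"
    by (intro L2_set_mono) (use row in auto)
  also have "\<dots> = frobenius_norm A * pnorm 2 x"
    by (simp add: frobenius_norm_def dims flip: L2_set_left_distrib)
  finally show ?thesis .
qed

lemma frobenius_norm_le_of_columns:
  assumes A: "A \<in> carrier_mat m n" and c: "0 \<le> c"
    and col: "\<And>j. j < n \<Longrightarrow> pnorm 2 (col A j) \<le> c"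
  shows "frobenius_norm A \<le> sqrt n * c"
proof -
  have dims: "dim_row A = m" "dim_col A = n" using assms by auto
  have "(\<Sum>i<m. \<Sum>j<n. (A $$ (i, j))\<^sup>2) = (\<Sum>j<n. (pnorm 2 (col A j))\<^sup>2)"
    unfolding pnorm_2_square using dims
    by (subst sum.swap) (auto intro!: sum.cong simp: power2_eq_square)
  also have "\<dots> \<le> (\<Sum>j<n. c\<^sup>2)"
    by (intro sum_mono power_mono) (use col in auto)
  finally have "frobenius_norm A \<le> sqrt (n * c\<^sup>2)"
    by (simp add: frobenius_norm_def L2_set_def sum_nonneg dims)
  with c show ?thesis by (simp add: real_sqrt_mult)
qed

text \<open>Scaling \<open>x\<close> to length one places the image in the set whose supremum is
  \<open>spectral_norm A\<close>. The Frobenius bound shows that this set is bounded above, without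
  which \<open>Sup\<close> would say nothing.\<close>

lemma pnorm_2_mult_mat_vec_le_spectral:
  assumes A: "A \<in> carrier_mat m n" and x: "x \<in> carrier_vec n"
  shows "pnorm 2 (A *\<^sub>v x) \<le> spectral_norm A * pnorm 2 x"
proof (cases "pnorm 2 x = 0")
  case True
  then show ?thesis using pnorm_2_mult_mat_vec_le_frobenius[OF A x] by simp
next
  case False
  then have pos: "0 < pnorm 2 x" using pnorm_nonneg[of 2 x] by linarith
  let ?B = "{pnorm 2 (A *\<^sub>v x) | x. x \<in> carrier_vec (dim_col A) \<and> pnorm 2 x \<le> 1}"
  let ?u = "(1 / pnorm 2 x) \<cdot>\<^sub>v x"
  have "bdd_above ?B"
  proof (rule bdd_aboveI)
    fix b assume "b \<in> ?B"
    then obtain y where y: "b = pnorm 2 (A *\<^sub>v y)" "y \<in> carrier_vec n" "pnorm 2 y \<le> 1"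
      using A by auto
    have "b \<le> frobenius_norm A * pnorm 2 y"
      unfolding y(1) by (rule pnorm_2_mult_mat_vec_le_frobenius[OF A y(2)])
    also have "\<dots> \<le> frobenius_norm A * 1"
      using y(3) by (intro mult_left_mono) auto
    finally show "b \<le> frobenius_norm A" by simp
  qed
  moreover have "pnorm 2 (A *\<^sub>v ?u) \<in> ?B"
    using pos x A by (intro CollectI exI[of _ ?u]) (auto simp: pnorm_smult)
  ultimately have "pnorm 2 (A *\<^sub>v ?u) \<le> spectral_norm A"
    unfolding spectral_norm_def by (intro cSup_upper)
  moreover have "pnorm 2 (A *\<^sub>v ?u) = pnorm 2 (A *\<^sub>v x) / pnorm 2 x"
    using pos by (simp add: mult_mat_vec[OF A x] pnorm_smult)
  ultimately show ?thesis using pos by (simp add: field_simps)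
qed

section \<open>Sequential compactness\<close>

text \<open>Bolzano-Weierstrass, by induction on the number of coordinates: each new coordinate
  passes to a further subsequence, along which the earlier limits persist.\<close>

lemma bounded_vec_sequence_convergent_subsequence:
  fixes s :: "nat \<Rightarrow> real vec"
  assumes "\<And>k i. i < n \<Longrightarrow> \<bar>s k $ i\<bar> \<le> B"
  shows "\<exists>l r. l \<in> carrier_vec n \<and> strict_mono (r :: nat \<Rightarrow> nat) \<and>
    (\<forall>i<n. (\<lambda>k. s (r k) $ i) \<longlonglongrightarrow> l $ i)"
proof -
  have "\<exists>l r. strict_mono (r :: nat \<Rightarrow> nat) \<and> (\<forall>i<N. (\<lambda>k. s (r k) $ i) \<longlonglongrightarrow> l i)"
    if "N \<le> n" for N
    using that
  proof (induction N)
    case 0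
    then show ?case by (auto intro!: exI[of _ id] strict_mono_id)
  next
    case (Suc N)
    then obtain l r where r: "strict_mono (r :: nat \<Rightarrow> nat)"
      and l: "\<And>i. i < N \<Longrightarrow> (\<lambda>k. s (r k) $ i) \<longlonglongrightarrow> l i" by auto
    have "\<forall>k. s (r k) $ N \<in> {-B..B}"
      using assms[of N] Suc.prems by (auto simp: abs_le_iff minus_le_iff)
    then obtain a q where q: "strict_mono q" "((\<lambda>k. s (r k) $ N) \<circ> q) \<longlonglongrightarrow> a"
      using seq_compactE[of "{-B..B}" "\<lambda>k. s (r k) $ N"] compact_imp_seq_compact[OF compact_Icc] by metis
    have "(\<lambda>k. s ((r \<circ> q) k) $ i) \<longlonglongrightarrow> (l(N := a)) i" if "i < Suc N" for i
    proof (cases "i = N")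
      case True then show ?thesis using q by (simp add: o_def)
    next
      case False
      with that have "i < N" by simp
      from LIMSEQ_subseq_LIMSEQ[OF l[OF this] q(1)] False show ?thesis by (simp add: o_def)
    qed
    moreover have "strict_mono (r \<circ> q)" using r q(1) by (rule strict_mono_o)
    ultimately show ?case by blast
  qed
  from this[OF order_refl] obtain l r where "strict_mono (r :: nat \<Rightarrow> nat)"
    "\<forall>i<n. (\<lambda>k. s (r k) $ i) \<longlonglongrightarrow> l i" by blast
  then show ?thesis by (intro exI[of _ "Matrix.vec n l"] exI[of _ r]) auto
qed

text \<open>Convergence of the finitely many coordinates forces \<open>vec_dist\<close> to the limit
  to tend to 0, and closed sets of a metric space contain the limits of their sequences.\<close>

lemma closed_vec_set_sequentially:
  assumes cl: "closed_vec_set n \<Omega>" and s: "\<And>k. s k \<in> \<Omega>" and l: "l \<in> carrier_vec n"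
    and lim: "\<And>i. i < n \<Longrightarrow> (\<lambda>k. s k $ i) \<longlonglongrightarrow> l $ i"
  shows "l \<in> \<Omega>"
proof -
  interpret Metric_space "carrier_vec n" "vec_dist n" by (rule Metric_space_vec_dist)
  have seq: "\<Omega> \<subseteq> carrier_vec n" "\<And>\<sigma> l. range \<sigma> \<subseteq> \<Omega> \<Longrightarrow> limitin mtopology \<sigma> l sequentially \<Longrightarrow> l \<in> \<Omega>"
    using cl unfolding closed_vec_set_def metric_closedin_iff_sequentially_closed by auto
  have "(\<lambda>k. vec_dist n (s k) l) \<longlonglongrightarrow> L2_set (\<lambda>i. l $ i - l $ i) {..<n}"
    unfolding vec_dist_def L2_set_def by (intro tendsto_intros lim) auto
  then have "(\<lambda>k. vec_dist n (s k) l) \<longlonglongrightarrow> 0" by (simp add: L2_set_def)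
  then have "limitin mtopology s l sequentially"
    unfolding limitin_metric using l subsetD[OF seq(1) s] by (auto simp: tendsto_iff vec_dist_def)
  with s show ?thesis by (intro seq(2)[of s]) auto
qed

section \<open>Finite-difference Jacobians\<close>

text \<open>Along the line in direction \<open>s\<close> the Frechet remainder is o(t), and A (t s)
  = t (A s), so each component of the difference quotient converges.\<close>

lemma directional_derivative:
  assumes F: "F \<in> carrier_vec n \<rightarrow> carrier_vec m" and A: "A \<in> carrier_mat m n"
    and x: "x \<in> carrier_vec n" and s: "s \<in> carrier_vec n" and i: "i < m"
    and diff: "\<forall>e>0. \<exists>\<delta>>0. \<forall>s\<in>carrier_vec n. pnorm 2 s < \<delta> \<longrightarrow>
        pnorm 2 (F (x + s) - F x - A *\<^sub>v s) \<le> e * pnorm 2 s"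
  shows "((\<lambda>t. F (x + t \<cdot>\<^sub>v s) $ i) has_real_derivative (A *\<^sub>v s) $ i) (at 0)"
  unfolding DERIV_def
proof (rule LIM_I)
  fix r :: real assume "0 < r"
  let ?N = "pnorm 2 s"
  \<comment> \<open>Using \<open>?N + 1\<close> in place of \<open>?N\<close> admits s = 0 and makes
    the final estimate strict.\<close>
  have N1: "0 < ?N + 1" using pnorm_nonneg[of 2 s] by linarith
  have e: "0 < r / (?N + 1)" using N1 \<open>0 < r\<close> by simp
  then obtain \<delta> where \<delta>: "\<delta> > 0" and bound: "\<And>s. s \<in> carrier_vec n \<Longrightarrow> pnorm 2 s < \<delta> \<Longrightarrow>
      pnorm 2 (F (x + s) - F x - A *\<^sub>v s) \<le> r / (?N + 1) * pnorm 2 s"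
    using diff by blast
  have x0: "x + 0 \<cdot>\<^sub>v s = x" using x s by (intro eq_vecI) auto
  have "norm ((F (x + (0 + t) \<cdot>\<^sub>v s) $ i - F (x + 0 \<cdot>\<^sub>v s) $ i) / t - (A *\<^sub>v s) $ i) < r"
    if t: "t \<noteq> 0" "norm (t - 0) < \<delta> / (?N + 1)" for t
  proof -
    have ts: "t \<cdot>\<^sub>v s \<in> carrier_vec n" using s by simp
    have Fc: "F (x + t \<cdot>\<^sub>v s) \<in> carrier_vec m" "F x \<in> carrier_vec m"
      using F x ts by auto
    have "\<bar>t\<bar> * ?N \<le> \<bar>t\<bar> * (?N + 1)" by (intro mult_left_mono) auto
    also have "\<dots> < \<delta>" using t N1 by (simp add: field_simps)
    finally have small: "pnorm 2 (t \<cdot>\<^sub>v s) < \<delta>" by (simp add: pnorm_smult)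
    let ?R = "F (x + t \<cdot>\<^sub>v s) - F x - A *\<^sub>v (t \<cdot>\<^sub>v s)"
    have "\<bar>?R $ i\<bar> \<le> pnorm 2 ?R" using i A by (intro abs_index_le_pnorm_2) auto
    also have "\<dots> \<le> r / (?N + 1) * (\<bar>t\<bar> * ?N)"
      using bound[OF ts small] by (simp add: pnorm_smult)
    also have "\<dots> < r / (?N + 1) * (\<bar>t\<bar> * (?N + 1))"
      using e t by (intro mult_strict_left_mono) auto
    also have "\<dots> = r * \<bar>t\<bar>" using N1 by simp
    finally have "\<bar>F (x + t \<cdot>\<^sub>v s) $ i - F x $ i - t * (A *\<^sub>v s) $ i\<bar> < r * \<bar>t\<bar>"
      using i A Fc by (simp add: mult_mat_vec[OF A s])
    moreover have "(F (x + t \<cdot>\<^sub>v s) $ i - F x $ i) / t - (A *\<^sub>v s) $ i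
        = (F (x + t \<cdot>\<^sub>v s) $ i - F x $ i - t * (A *\<^sub>v s) $ i) / t"
      using t(1) by (simp add: field_simps)
    ultimately show ?thesis using t(1) x0 by (simp add: field_simps)
  qed
  then show "\<exists>d>0. \<forall>t. t \<noteq> 0 \<and> norm (t - 0) < d \<longrightarrow>
      norm ((F (x + (0 + t) \<cdot>\<^sub>v s) $ i - F (x + 0 \<cdot>\<^sub>v s) $ i) / t - (A *\<^sub>v s) $ i) < r"
    using \<delta> N1 by (intro exI[of _ "\<delta> / (?N + 1)"]) auto
qed

lemma jacobian_mat_carrier [simp]: "jacobian_mat n m F x \<in> carrier_mat m n"
  by (simp add: jacobian_mat_def)

lemma jacobian_mat_dim [simp]:
  "dim_row (jacobian_mat n m F x) = m" "dim_col (jacobian_mat n m F x) = n"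
  by (simp_all add: jacobian_mat_def)

text \<open>Testing a Frechet derivative on the unit vectors yields the partial derivatives, so the
  matrix defined entrywise through \<open>deriv\<close> is the true Jacobian.\<close>

lemma jacobian_mat_eq_differential:
  assumes F: "F \<in> carrier_vec n \<rightarrow> carrier_vec m" and A: "A \<in> carrier_mat m n"
    and x: "x \<in> carrier_vec n"
    and diff: "\<forall>e>0. \<exists>\<delta>>0. \<forall>s\<in>carrier_vec n. pnorm 2 s < \<delta> \<longrightarrow>
        pnorm 2 (F (x + s) - F x - A *\<^sub>v s) \<le> e * pnorm 2 s"
  shows "jacobian_mat n m F x = A"
proof (rule eq_matI)
  fix i j assume "i < dim_row A" "j < dim_col A"
  then have ij: "i < m" "j < n" using A by auto
  have "deriv (\<lambda>t. F (x + t \<cdot>\<^sub>v unit_vec n j) $ i) 0 = (A *\<^sub>v unit_vec n j) $ i"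
    by (intro DERIV_imp_deriv directional_derivative[OF F A x _ ij(1) diff]) simp
  also have "\<dots> = A $$ (i, j)" using A ij by simp
  finally show "jacobian_mat n m F x $$ (i, j) = A $$ (i, j)"
    using ij by (simp add: jacobian_mat_def)
qed (use A in \<open>auto simp: jacobian_mat_def\<close>)

lemma jacobian_mat_directional_derivative:
  assumes F: "F \<in> carrier_vec n \<rightarrow> carrier_vec m" and diff: "differentiable_at_vec n m F x"
    and x: "x \<in> carrier_vec n" and s: "s \<in> carrier_vec n" and i: "i < m"
  shows "((\<lambda>t. F (x + t \<cdot>\<^sub>v s) $ i) has_real_derivative (jacobian_mat n m F x *\<^sub>v s) $ i) (at 0)"
proof -
  obtain A where A: "A \<in> carrier_mat m n" and *: "\<forall>e>0. \<exists>\<delta>>0. \<forall>s\<in>carrier_vec n. pnorm 2 s < \<delta> \<longrightarrow>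
        pnorm 2 (F (x + s) - F x - A *\<^sub>v s) \<le> e * pnorm 2 s"
    using diff unfolding differentiable_at_vec_def by blast
  show ?thesis
    unfolding jacobian_mat_eq_differential[OF F A x *]
    by (rule directional_derivative[OF F A x s i *])
qed

section \<open>Maps with Lipschitz Jacobian: linearization and finite differences\<close>

locale lipschitz_jacobian =
  fixes n m :: nat and F :: "real vec \<Rightarrow> real vec" and L :: real
  assumes F_carrier: "F \<in> carrier_vec n \<rightarrow> carrier_vec m"
    and F_diff: "x \<in> carrier_vec n \<Longrightarrow> differentiable_at_vec n m F x"
    and jacobian_lipschitz: "x \<in> carrier_vec n \<Longrightarrow> y \<in> carrier_vec n \<Longrightarrow>
      spectral_norm (jacobian_mat n m F x - jacobian_mat n m F y) \<le> L * pnorm 2 (x - y)"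
    and L_pos: "0 < L"
begin

abbreviation "J \<equiv> jacobian_mat n m F"

lemma F_in [simp]: "x \<in> carrier_vec n \<Longrightarrow> F x \<in> carrier_vec m"
  using F_carrier by auto

lemma F_dim [simp]: "x \<in> carrier_vec n \<Longrightarrow> dim_vec (F x) = m"
  using F_in[of x] by auto

lemma line_derivative:
  assumes x: "x \<in> carrier_vec n" and s: "s \<in> carrier_vec n" and i: "i < m"
  shows "((\<lambda>t. F (x + t \<cdot>\<^sub>v s) $ i) has_real_derivative (J (x + t \<cdot>\<^sub>v s) *\<^sub>v s) $ i) (at t)"
proof -
  let ?y = "x + t \<cdot>\<^sub>v s"
  have y: "?y \<in> carrier_vec n" using x s by simp
  have "?y + u \<cdot>\<^sub>v s = x + (u + t) \<cdot>\<^sub>v s" for u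
    using x s by (intro eq_vecI) (auto simp: algebra_simps)
  then have "((\<lambda>u. F (x + (u + t) \<cdot>\<^sub>v s) $ i) has_real_derivative (J ?y *\<^sub>v s) $ i) (at 0)"
    using jacobian_mat_directional_derivative[OF F_carrier F_diff[OF y] y s i] by simp
  then show ?thesis
    using DERIV_shift[of "\<lambda>u. F (x + u \<cdot>\<^sub>v s) $ i" _ 0 t] by simp
qed

text \<open>
  The mean value theorem is applied to the component of \<open>F\<close> along the residual itself; it gives
  the constant \<open>L\<close> instead of \<open>L / 2\<close>, which is immaterial here.
\<close>

lemma linearization_error:
  assumes x: "x \<in> carrier_vec n" and s: "s \<in> carrier_vec n"
  shows "pnorm 2 (F (x + s) - F x - J x *\<^sub>v s) \<le> L * (pnorm 2 s)\<^sup>2"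
proof -
  define v where "v = F (x + s) - F x - J x *\<^sub>v s"
  have v: "v \<in> carrier_vec m"
    unfolding v_def by (intro carrier_vecI) simp
  define g where "g = (\<lambda>t. \<Sum>i<m. v $ i * F (x + t \<cdot>\<^sub>v s) $ i)"
  have "(g has_real_derivative (\<Sum>i<m. v $ i * (J (x + t \<cdot>\<^sub>v s) *\<^sub>v s) $ i)) (at t)" for t
    unfolding g_def by (intro DERIV_sum DERIV_cmult line_derivative[OF x s]) auto
  from MVT2[of 0 1 g, OF _ this] obtain \<xi> where \<xi>: "0 < \<xi>" "\<xi> < 1"
    and g: "g 1 - g 0 = (\<Sum>i<m. v $ i * (J (x + \<xi> \<cdot>\<^sub>v s) *\<^sub>v s) $ i)" by auto
  let ?y = "x + \<xi> \<cdot>\<^sub>v s" and ?N = "pnorm 2 s"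
  let ?w = "(J ?y - J x) *\<^sub>v s"
  have y: "?y \<in> carrier_vec n" using x s by simp
  have w: "?w = J ?y *\<^sub>v s - J x *\<^sub>v s"
    by (rule minus_mult_distrib_mat_vec[OF jacobian_mat_carrier jacobian_mat_carrier s])
  have wc: "?w \<in> carrier_vec m" by (rule mult_mat_vec_carrier[OF _ s]) auto
  have "1 \<cdot>\<^sub>v s = s" "x + 0 \<cdot>\<^sub>v s = x" using x s by (auto intro: eq_vecI)
  then have "g 1 - g 0 = (\<Sum>i<m. v $ i * (F (x + s) $ i - F x $ i))"
    by (simp add: g_def sum_subtractf algebra_simps)
  moreover have "(pnorm 2 v)\<^sup>2 = (\<Sum>i<m. v $ i * (F (x + s) $ i - F x $ i - (J x *\<^sub>v s) $ i))"
    unfolding pnorm_2_square using v x s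
    by (intro sum.cong) (auto simp: v_def)
  \<comment> \<open>In the product of \<open>v\<close> with itself, F(x + s) - F(x) contributes
    \<open>g 1 - g 0\<close>; only the change of the Jacobian between x and the intermediate point
    remains.\<close>
  ultimately have "(pnorm 2 v)\<^sup>2 = (\<Sum>i<m. v $ i * ((J ?y *\<^sub>v s) $ i - (J x *\<^sub>v s) $ i))"
    using g by (simp add: right_diff_distrib sum_subtractf)
  also have "\<dots> = (\<Sum>i<m. v $ i * ?w $ i)"
    unfolding w by (intro sum.cong) auto
  also have "\<dots> \<le> (\<Sum>i<m. \<bar>v $ i\<bar> * \<bar>?w $ i\<bar>)"
    by (intro sum_mono) (simp add: abs_mult[symmetric])
  also have "\<dots> \<le> pnorm 2 v * pnorm 2 ?w"
    unfolding pnorm_2_eq carrier_vecD[OF v] carrier_vecD[OF wc] by (rule L2_set_mult_ineq)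
  also have "pnorm 2 ?w \<le> spectral_norm (J ?y - J x) * ?N"
    by (rule pnorm_2_mult_mat_vec_le_spectral[OF _ s]) auto
  also have "spectral_norm (J ?y - J x) \<le> L * pnorm 2 (?y - x)"
    by (rule jacobian_lipschitz[OF y x])
  also have "?y - x = \<xi> \<cdot>\<^sub>v s" using x s by (intro eq_vecI) auto
  also have "L * pnorm 2 (\<xi> \<cdot>\<^sub>v s) \<le> L * ?N"
    using \<xi> L_pos by (simp add: pnorm_smult mult_left_le_one_le)
  finally have "pnorm 2 v * pnorm 2 v \<le> pnorm 2 v * (L * ?N\<^sup>2)"
    by (simp add: power2_eq_square mult.assoc mult_left_mono mult_right_mono)
  moreover have "0 \<le> L * ?N\<^sup>2" using L_pos by simp
  ultimately have "pnorm 2 v \<le> L * ?N\<^sup>2"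
    by (cases "pnorm 2 v = 0") (use pnorm_nonneg[of 2 v] in \<open>auto simp: mult_le_cancel_left\<close>)
  then show ?thesis by (simp add: v_def)
qed

text \<open>Column j of \<open>A - J x\<close> is the linearization residual of the step \<tau> e_j
  divided by \<tau>, hence at most L \<tau> in norm. The passage from columns to the whole matrix
  costs the factor sqrt n.\<close>

lemma finite_difference_model_error:
  assumes x: "x \<in> carrier_vec n" and s: "s \<in> carrier_vec n" and \<tau>: "0 < \<tau>"
    and fd: "finite_difference_model n m F x \<tau> A"
  shows "pnorm 2 (A *\<^sub>v s - J x *\<^sub>v s) \<le> L * \<tau> * sqrt n * pnorm 2 s"
proof -
  have A: "A \<in> carrier_mat m n"
    and col: "\<And>j. j < n \<Longrightarrow> col A j = (1 / \<tau>) \<cdot>\<^sub>v (F (x + \<tau> \<cdot>\<^sub>v unit_vec n j) - F x)"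
    using fd unfolding finite_difference_model_def by auto
  have "frobenius_norm (A - J x) \<le> sqrt n * (L * \<tau>)"
  proof (rule frobenius_norm_le_of_columns)
    fix j assume j: "j < n"
    let ?s = "\<tau> \<cdot>\<^sub>v unit_vec n j"
    have sc: "?s \<in> carrier_vec n" by simp
    let ?R = "F (x + ?s) - F x - J x *\<^sub>v ?s"
    have "col (A - J x) j = (1 / \<tau>) \<cdot>\<^sub>v ?R"
    proof (rule eq_vecI)
      fix i assume "i < dim_vec ((1 / \<tau>) \<cdot>\<^sub>v ?R)"
      then have i: "i < m" by simp
      have "A $$ (i, j) = col A j $ i" using A i j by simp
      also have "\<dots> = (F (x + ?s) $ i - F x $ i) / \<tau>"
        unfolding col[OF j] using x i by (simp add: carrier_vecD[OF F_in])
      finally show "col (A - J x) j $ i = ((1 / \<tau>) \<cdot>\<^sub>v ?R) $ i"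
        using A i j x \<tau>
        by (simp add: mult_mat_vec[OF jacobian_mat_carrier] field_simps)
    qed (use A in simp)
    then have "pnorm 2 (col (A - J x) j) \<le> (1 / \<tau>) * (L * (pnorm 2 ?s)\<^sup>2)"
      using linearization_error[OF x sc] \<tau> by (simp add: pnorm_smult divide_right_mono)
    also have "\<dots> = L * \<tau>"
      using \<tau> by (simp add: pnorm_smult pnorm_2_unit_vec[OF j] power2_eq_square)
    finally show "pnorm 2 (col (A - J x) j) \<le> L * \<tau>" .
  qed (use A L_pos \<tau> in auto)
  moreover have "pnorm 2 ((A - J x) *\<^sub>v s) \<le> frobenius_norm (A - J x) * pnorm 2 s"
    by (rule pnorm_2_mult_mat_vec_le_frobenius[OF _ s]) auto
  ultimately have "pnorm 2 ((A - J x) *\<^sub>v s) \<le> sqrt n * (L * \<tau>) * pnorm 2 s"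
    by (meson mult_right_mono order_trans pnorm_nonneg)
  then show ?thesis
    by (simp add: minus_mult_distrib_mat_vec[OF A jacobian_mat_carrier s] mult_ac)
qed

end

section \<open>Trust-region subproblems\<close>

lemma zero_feasible_step:
  assumes "x \<in> \<Omega>" "x \<in> carrier_vec n" "0 < p" "0 \<le> r"
  shows "0\<^sub>v n \<in> feasible_steps n p \<Omega> r x"
  using assms by (simp add: feasible_steps_def pnorm_def zero_power)

text \<open>The outer function enters only through convexity and one Lipschitz constant for the
  2-norm, which will be K = L_{h,p} c_{p,2}(m); the index \<open>p\<close> survives only in the
  shape of the trust region.\<close>

locale composite_problem = lipschitz_jacobian n m F L for n m F L +
  fixes p :: nat and h :: "real vec \<Rightarrow> real" and K :: real and \<Omega> :: "real vec set"
  assumes p: "p \<in> {1, 2}" and n_pos: "0 < n"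
    and K_pos: "0 < K"
    and h_lipschitz: "z \<in> carrier_vec m \<Longrightarrow> w \<in> carrier_vec m \<Longrightarrow> \<bar>h z - h w\<bar> \<le> K * pnorm 2 (z - w)"
    and h_convex: "z \<in> carrier_vec m \<Longrightarrow> w \<in> carrier_vec m \<Longrightarrow> 0 \<le> t \<Longrightarrow> t \<le> 1 \<Longrightarrow>
      h ((1 - t) \<cdot>\<^sub>v z + t \<cdot>\<^sub>v w) \<le> (1 - t) * h z + t * h w"
    and \<Omega>_subset: "\<Omega> \<subseteq> carrier_vec n"
    and \<Omega>_closed: "closed_vec_set n \<Omega>"
    and \<Omega>_convex: "convex_vec_set \<Omega>"
begin

abbreviation "steps \<equiv> feasible_steps n p \<Omega>"
abbreviation "\<eta> \<equiv> eta n p h F \<Omega>"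
abbreviation "\<psi> \<equiv> psi n m p h F \<Omega>"

lemma p_pos: "0 < p" using p by auto

lemma pnorm_2_le: "pnorm 2 s \<le> pnorm p s"
  using p pnorm_2_le_pnorm_1 by auto

lemma \<Omega>_carrier: "x \<in> \<Omega> \<Longrightarrow> x \<in> carrier_vec n"
  using \<Omega>_subset by auto

lemma stepsD:
  assumes "s \<in> steps r x"
  shows "s \<in> carrier_vec n" "x + s \<in> \<Omega>" "pnorm 2 s \<le> r"
  using assms pnorm_2_le[of s] by (auto simp: feasible_steps_def)

lemma value_in_carrier:
  assumes "x \<in> carrier_vec n" "A \<in> carrier_mat m n" "s \<in> carrier_vec n"
  shows "F x + A *\<^sub>v s \<in> carrier_vec m"
  using assms by auto

lemma h_shift_lipschitz:
  assumes x: "x \<in> carrier_vec n" and u: "u \<in> carrier_vec m" and v: "v \<in> carrier_vec m"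
  shows "\<bar>h (F x + u) - h (F x + v)\<bar> \<le> K * pnorm 2 (u - v)"
proof -
  have "(F x + u) - (F x + v) = u - v"
    using x u v by (intro eq_vecI) auto
  then show ?thesis
    using h_lipschitz[of "F x + u" "F x + v"] F_in[OF x] u v by simp
qed

text \<open>The feasible steps are bounded and closed under coordinatewise limits, and the model is
  Lipschitz in the step. Compactness is shown for the set of model values in the reals: a
  subsequence of the steps converges, and its values converge with it.\<close>

lemma minimizer_exists:
  assumes x: "x \<in> \<Omega>" and A: "A \<in> carrier_mat m n" and r: "0 \<le> r"
  obtains d where "d \<in> steps r x" "\<And>s. s \<in> steps r x \<Longrightarrow> h (F x + A *\<^sub>v d) \<le> h (F x + A *\<^sub>v s)"
proof -
  define g where "g = (\<lambda>s. h (F x + A *\<^sub>v s))"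
  note xc = \<Omega>_carrier[OF x]
  have g_lipschitz: "\<bar>g s - g l\<bar> \<le> K * (frobenius_norm A * pnorm 2 (s - l))"
    if "s \<in> carrier_vec n" "l \<in> carrier_vec n" for s l
  proof -
    have "\<bar>g s - g l\<bar> \<le> K * pnorm 2 (A *\<^sub>v s - A *\<^sub>v l)"
      unfolding g_def using A that by (intro h_shift_lipschitz xc) auto
    also have "A *\<^sub>v s - A *\<^sub>v l = A *\<^sub>v (s - l)"
      by (rule mult_minus_distrib_mat_vec[OF A that, symmetric])
    also have "pnorm 2 (A *\<^sub>v (s - l)) \<le> frobenius_norm A * pnorm 2 (s - l)"
      using that by (intro pnorm_2_mult_mat_vec_le_frobenius[OF A]) auto
    finally show ?thesis using K_pos by simp
  qed
  have "compact (g ` steps r x)"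
    unfolding compact_eq_seq_compact_metric
  proof (rule seq_compactI)
    fix f :: "nat \<Rightarrow> real" assume "\<forall>k. f k \<in> g ` steps r x"
    then obtain s where s: "\<And>k. s k \<in> steps r x" and f: "\<And>k. f k = g (s k)"
      unfolding image_iff by metis
    note sD = stepsD[OF s]
    have dim: "dim_vec (s k) = n" for k using sD(1)[of k] by auto
    have "\<bar>s k $ i\<bar> \<le> r" if "i < n" for k i
      using abs_index_le_pnorm_2[of i "s k"] sD(3)[of k] that dim[of k] by auto
    then obtain l q where l: "l \<in> carrier_vec n" and q: "strict_mono (q :: nat \<Rightarrow> nat)"
      and lim: "\<And>i. i < n \<Longrightarrow> (\<lambda>k. s (q k) $ i) \<longlonglongrightarrow> l $ i"
      using bounded_vec_sequence_convergent_subsequence[of n s r] by blast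
    have diml: "dim_vec l = n" using l by auto
    have "x + l \<in> \<Omega>"
    proof (rule closed_vec_set_sequentially[OF \<Omega>_closed, of "\<lambda>k. x + s (q k)"])
      show "(\<lambda>k. (x + s (q k)) $ i) \<longlonglongrightarrow> (x + l) $ i" if "i < n" for i
        using that lim[OF that] xc by (auto simp: dim diml intro!: tendsto_intros)
    qed (use sD xc l in auto)
    moreover have "(\<lambda>k. pnorm p (s (q k))) \<longlonglongrightarrow> pnorm p l"
      unfolding pnorm_def dim diml by (intro tendsto_intros lim) auto
    then have "pnorm p l \<le> r"
      by (rule LIMSEQ_le_const2) (use s in \<open>auto simp: feasible_steps_def\<close>)
    ultimately have "l \<in> steps r x" using l by (simp add: feasible_steps_def)
    moreover have "(f \<circ> q) \<longlonglongrightarrow> g l"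
    proof (rule metric_tendsto_imp_tendsto)
      have "(\<lambda>k. pnorm 2 (s (q k) - l)) \<longlonglongrightarrow> L2_set (\<lambda>i. l $ i - l $ i) {..<n}"
        unfolding vec_dist_eq_pnorm[OF l, symmetric] vec_dist_def L2_set_def
        by (intro tendsto_intros lim) auto
      then have "(\<lambda>k. pnorm 2 (s (q k) - l)) \<longlonglongrightarrow> 0" by (simp add: L2_set_def)
      from tendsto_mult_right_zero[OF tendsto_mult_right_zero[OF this]]
      show "(\<lambda>k. K * (frobenius_norm A * pnorm 2 (s (q k) - l))) \<longlonglongrightarrow> 0" by blast
      show "\<forall>\<^sub>F k in sequentially. dist ((f \<circ> q) k) (g l)
          \<le> dist (K * (frobenius_norm A * pnorm 2 (s (q k) - l))) 0"
        using g_lipschitz[OF sD(1) l] K_pos by (auto simp: f dist_real_def abs_mult)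
    qed
    ultimately show "\<exists>l\<in>g ` steps r x. \<exists>r. strict_mono r \<and> (f \<circ> r) \<longlonglongrightarrow> l"
      using q by blast
  qed
  moreover have "steps r x \<noteq> {}"
    using zero_feasible_step[OF x xc p_pos r] by auto
  ultimately obtain d where "d \<in> steps r x" "\<forall>s\<in>steps r x. g d \<le> g s"
    using compact_attains_inf[of "g ` steps r x"] by auto
  then show ?thesis using that by (auto simp: g_def)
qed

text \<open>An attained minimum gives the \<open>LEAST\<close> in \<open>eta\<close> its intended
  value; all estimates of \<open>eta\<close> go through this identity.\<close>

lemma eta_eq_at_minimizer:
  assumes "d \<in> steps r x" "\<And>s. s \<in> steps r x \<Longrightarrow> h (F x + A *\<^sub>v d) \<le> h (F x + A *\<^sub>v s)"
  shows "\<eta> r x A = (h (F x) - h (F x + A *\<^sub>v d)) / r"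
proof -
  have "(LEAST v. \<exists>s\<in>steps r x. v = h (F x + A *\<^sub>v s)) = h (F x + A *\<^sub>v d)"
    using assms by (intro Least_equality) auto
  then show ?thesis by (simp add: eta_def)
qed

lemma eta_ge:
  assumes x: "x \<in> \<Omega>" and A: "A \<in> carrier_mat m n" and r: "0 < r" and s: "s \<in> steps r x"
  shows "(h (F x) - h (F x + A *\<^sub>v s)) / r \<le> \<eta> r x A"
proof -
  obtain d where d: "d \<in> steps r x" "\<And>s. s \<in> steps r x \<Longrightarrow> h (F x + A *\<^sub>v d) \<le> h (F x + A *\<^sub>v s)"
    using minimizer_exists[OF x A] r by (metis less_imp_le)
  show ?thesis
    using eta_eq_at_minimizer[OF d] d(2)[OF s] r by (simp add: divide_right_mono)
qed

text \<open>The minimizer of the exact linear model competes in the approximate one, and there the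
  two models differ by at most K L sqrt n \<tau> r. Hence a failed test in Step 2 at a nonstationary
  point reveals that \<tau> is still large.\<close>

lemma psi_le_eta:
  assumes x: "x \<in> \<Omega>" and \<tau>: "0 < \<tau>" and fd: "finite_difference_model n m F x \<tau> A" and r: "0 < r"
  shows "\<psi> r x \<le> \<eta> r x A + K * L * sqrt n * \<tau>"
proof -
  note xc = \<Omega>_carrier[OF x]
  have A: "A \<in> carrier_mat m n" using fd by (simp add: finite_difference_model_def)
  obtain d where d: "d \<in> steps r x" "\<And>s. s \<in> steps r x \<Longrightarrow> h (F x + J x *\<^sub>v d) \<le> h (F x + J x *\<^sub>v s)"
    using minimizer_exists[OF x jacobian_mat_carrier, of r] r by (metis less_imp_le)
  note dD = stepsD[OF d(1)]
  have "h (F x + A *\<^sub>v d) - h (F x + J x *\<^sub>v d) \<le> K * pnorm 2 (A *\<^sub>v d - J x *\<^sub>v d)"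
    using h_shift_lipschitz[OF xc, of "A *\<^sub>v d" "J x *\<^sub>v d"] A dD(1)
      mult_mat_vec_carrier[OF jacobian_mat_carrier dD(1)] by auto
  also have "pnorm 2 (A *\<^sub>v d - J x *\<^sub>v d) \<le> L * \<tau> * sqrt n * pnorm 2 d"
    by (rule finite_difference_model_error[OF xc dD(1) \<tau> fd])
  also have "\<dots> \<le> L * \<tau> * sqrt n * r"
    using L_pos \<tau> dD(3) by (intro mult_left_mono) auto
  finally have "(h (F x) - h (F x + J x *\<^sub>v d)) / r
      \<le> (h (F x) - h (F x + A *\<^sub>v d) + K * (L * \<tau> * sqrt n * r)) / r"
    using K_pos r by (intro divide_right_mono) auto
  also have "\<dots> = (h (F x) - h (F x + A *\<^sub>v d)) / r + K * L * sqrt n * \<tau>"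
    using r by (simp add: field_simps)
  also have "(h (F x) - h (F x + A *\<^sub>v d)) / r \<le> \<eta> r x A"
    by (rule eta_ge[OF x A r d(1)])
  finally show ?thesis
    using eta_eq_at_minimizer[OF d] by (simp add: psi_def)
qed

text \<open>
  Scaling a minimizer over the ball of radius \<open>R\<close> by \<open>r / R\<close> gives a feasible step of length at most
  \<open>r\<close>, and convexity of \<open>h\<close> bounds the decrease that it achieves.
\<close>

lemma model_decrease:
  assumes x: "x \<in> \<Omega>" and A: "A \<in> carrier_mat m n" and r: "0 < r" "r \<le> R" and \<theta>: "0 \<le> \<theta>"
    and d: "acceptable_trial n p h F \<Omega> \<theta> r x A d"
  shows "\<theta> * r * \<eta> R x A \<le> h (F x) - h (F x + A *\<^sub>v d)"
proof -
  note xc = \<Omega>_carrier[OF x]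
  obtain d' where d': "d' \<in> steps r x" "\<And>s. s \<in> steps r x \<Longrightarrow> h (F x + A *\<^sub>v d') \<le> h (F x + A *\<^sub>v s)"
    "\<theta> * (h (F x) - h (F x + A *\<^sub>v d')) \<le> h (F x) - h (F x + A *\<^sub>v d)"
    using d unfolding acceptable_trial_def by blast
  have R: "0 < R" using r by linarith
  obtain s where s: "s \<in> steps R x" "\<And>u. u \<in> steps R x \<Longrightarrow> h (F x + A *\<^sub>v s) \<le> h (F x + A *\<^sub>v u)"
    using minimizer_exists[OF x A] R by (metis less_imp_le)
  note sD = stepsD[OF s(1)]
  define t where "t = r / R"
  have t: "0 < t" "t \<le> 1" "t * R = r" using r R by (auto simp: t_def)
  have "t \<cdot>\<^sub>v s \<in> steps r x"
  proof -
    have "(1 - t) \<cdot>\<^sub>v x + t \<cdot>\<^sub>v (x + s) \<in> \<Omega>"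
      using \<Omega>_convex x sD(2) t unfolding convex_vec_set_def by auto
    also have "(1 - t) \<cdot>\<^sub>v x + t \<cdot>\<^sub>v (x + s) = x + t \<cdot>\<^sub>v s"
      using xc sD(1) by (intro eq_vecI) (auto simp: algebra_simps)
    finally have "x + t \<cdot>\<^sub>v s \<in> \<Omega>" .
    moreover have "pnorm p (t \<cdot>\<^sub>v s) \<le> r"
      using s(1) t mult_left_mono[of "pnorm p s" R t] p_pos
      by (auto simp: feasible_steps_def pnorm_smult)
    ultimately show ?thesis using sD(1) by (simp add: feasible_steps_def)
  qed
  then have "h (F x + A *\<^sub>v d') \<le> h (F x + A *\<^sub>v (t \<cdot>\<^sub>v s))" by (rule d'(2))
  also have "F x + A *\<^sub>v (t \<cdot>\<^sub>v s) = (1 - t) \<cdot>\<^sub>v F x + t \<cdot>\<^sub>v (F x + A *\<^sub>v s)"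
    unfolding mult_mat_vec[OF A sD(1)]
    using carrier_vecD[OF F_in[OF xc]] A by (intro eq_vecI) (auto simp: algebra_simps)
  also have "h \<dots> \<le> (1 - t) * h (F x) + t * h (F x + A *\<^sub>v s)"
    using t by (intro h_convex value_in_carrier F_in xc A sD(1)) auto
  finally have "t * (h (F x) - h (F x + A *\<^sub>v s)) \<le> h (F x) - h (F x + A *\<^sub>v d')"
    by (simp add: algebra_simps)
  moreover have "t * (h (F x) - h (F x + A *\<^sub>v s)) = r * \<eta> R x A"
    using eta_eq_at_minimizer[OF s] by (simp add: t_def)
  ultimately show ?thesis
    using mult_left_mono[OF _ \<theta>, of "r * \<eta> R x A" "h (F x) - h (F x + A *\<^sub>v d')"] d'(3)
    by (simp add: mult.assoc)
qed

text \<open>Two errors of size L r^2 add up: linearizing F, and replacing the Jacobian by the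
  difference matrix. The hypothesis \<open>\<tau> * sqrt n \<le> r\<close> removes n from the
  second, which keeps the trust-region analysis free of the dimension.\<close>

lemma model_error_at_step:
  assumes x: "x \<in> carrier_vec n" and s: "s \<in> carrier_vec n" and len: "pnorm 2 s \<le> r"
    and \<tau>: "0 < \<tau>" "\<tau> * sqrt n \<le> r" and fd: "finite_difference_model n m F x \<tau> A"
  shows "h (F (x + s)) - h (F x + A *\<^sub>v s) \<le> 2 * K * L * r\<^sup>2"
proof -
  have A: "A \<in> carrier_mat m n" using fd by (simp add: finite_difference_model_def)
  have r: "0 \<le> r" using len pnorm_nonneg[of 2 s] by linarith
  let ?u = "F (x + s) - F x - J x *\<^sub>v s" and ?v = "J x *\<^sub>v s - A *\<^sub>v s"
  have Fs: "F (x + s) \<in> carrier_vec m" using x s by simp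
  have "pnorm 2 ?v = pnorm 2 (A *\<^sub>v s - J x *\<^sub>v s)"
    using A by (auto simp: pnorm_2_eq L2_set_def power2_commute intro!: arg_cong[of _ _ sqrt] sum.cong)
  also have "\<dots> \<le> L * \<tau> * sqrt n * pnorm 2 s"
    by (rule finite_difference_model_error[OF x s \<tau>(1) fd])
  also have "\<dots> = L * (\<tau> * sqrt n * pnorm 2 s)" by simp
  also have "\<dots> \<le> L * (r * r)"
    using L_pos \<tau> len r by (intro mult_left_mono mult_mono) auto
  finally have v: "pnorm 2 ?v \<le> L * r\<^sup>2" by (simp add: power2_eq_square)
  have "pnorm 2 ?u \<le> L * (pnorm 2 s)\<^sup>2" by (rule linearization_error[OF x s])
  also have "\<dots> \<le> L * r\<^sup>2" using L_pos len by (intro mult_left_mono power_mono) auto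
  finally have u: "pnorm 2 ?u \<le> L * r\<^sup>2" .
  have "h (F (x + s)) - h (F x + A *\<^sub>v s) \<le> K * pnorm 2 (F (x + s) - (F x + A *\<^sub>v s))"
    using h_lipschitz[OF Fs value_in_carrier[OF x A s]] by linarith
  also have "F (x + s) - (F x + A *\<^sub>v s) = ?u + ?v"
    using carrier_vecD[OF Fs] carrier_vecD[OF F_in[OF x]] A by (intro eq_vecI) auto
  also have "pnorm 2 (?u + ?v) \<le> pnorm 2 ?u + pnorm 2 ?v"
    using A by (intro pnorm_2_triangle) simp
  also have "\<dots> \<le> 2 * L * r\<^sup>2" using u v by simp
  finally show ?thesis using K_pos by (simp add: mult_ac)
qed

end

section \<open>Counting iterations\<close>

text \<open>The initial difference step is an arbitrary positive number, made admissible by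
  \<open>run\<close>; within this locale its formula from Step 0 enters only in
  \<open>potential_0_le\<close>.\<close>

locale trfd_execution = composite_problem n m F L p h K \<Omega>
  for n m F L p h K \<Omega> +
  fixes \<epsilon> \<alpha> \<theta> \<tau>\<^sub>0 \<Delta>\<^sub>0 \<Delta>max f_low :: real and x\<^sub>0 :: "real vec" and S :: "nat \<Rightarrow> trfd_state"
  assumes \<epsilon>: "0 < \<epsilon>" "\<epsilon> \<le> 1" and \<alpha>: "0 < \<alpha>" "\<alpha> < 1" and \<theta>: "0 < \<theta>"
    and \<tau>\<^sub>0: "0 < \<tau>\<^sub>0" and \<Delta>\<^sub>0: "0 < \<Delta>\<^sub>0"
    and x\<^sub>0: "x\<^sub>0 \<in> \<Omega>"
    and f_low: "x \<in> carrier_vec n \<Longrightarrow> f_low \<le> h (F x)"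
    and run: "trfd_run n m p h F \<Omega> x\<^sub>0 \<epsilon> \<alpha> \<theta> \<tau>\<^sub>0 \<Delta>\<^sub>0 \<Delta>max S"
begin

abbreviation "X k \<equiv> iterate (S k)"
abbreviation "\<Delta> k \<equiv> radius (S k)"
abbreviation "\<tau> k \<equiv> fd_step (S k)"
abbreviation "A k \<equiv> model (S k)"
abbreviation "d k \<equiv> trial (S k)"
abbreviation "step3 k \<equiv> reaches_step3 n p h F \<Omega> \<epsilon> \<Delta>max (S k)"
abbreviation "\<rho> k \<equiv> reduction_ratio h F (S k)"

text \<open>Chosen so that rejection implies a radius of at least 2 \<kappa> \<epsilon>: the 8 is
  twice the 4 that the rejection estimate produces, leaving room for one halving. Since \<epsilon>
  \<le> 1, the minimum makes the initial radius comply.\<close>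

definition "\<kappa> = min \<Delta>\<^sub>0 ((1 - \<alpha>) * \<theta> / (8 * K * L))"

lemma \<kappa>_pos: "0 < \<kappa>"
  using \<Delta>\<^sub>0 \<alpha> \<theta> K_pos L_pos by (simp add: \<kappa>_def)

section \<open>Transitions between consecutive iterations\<close>

lemma initial_state:
  "X 0 = x\<^sub>0" "\<Delta> 0 = \<Delta>\<^sub>0" "\<tau> 0 = \<tau>\<^sub>0" "at_step1 (S 0)"
  "\<tau>\<^sub>0 * sqrt n \<le> \<Delta>\<^sub>0" "\<Delta>\<^sub>0 \<le> \<Delta>max"
  using run unfolding trfd_run_def by blast+

lemma iteration: "trfd_iteration n m p h F \<Omega> \<epsilon> \<alpha> \<theta> \<Delta>max (S k) (S (Suc k))"
  using run by (simp add: trfd_run_def)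

lemma step1_model: "at_step1 (S k) \<Longrightarrow> finite_difference_model n m F (X k) (\<tau> k) (A k)"
  using iteration[of k] by (simp add: trfd_iteration_def)

lemma refinement:
  assumes "\<not> step3 k"
  shows "X (Suc k) = X k" "\<Delta> (Suc k) = \<Delta> k" "\<tau> (Suc k) = \<tau> k / 2" "at_step1 (S (Suc k))"
  using iteration[of k] assms by (auto simp: trfd_iteration_def)

lemma trial_acceptable:
  "step3 k \<Longrightarrow> acceptable_trial n p h F \<Omega> \<theta> (\<Delta> k) (X k) (A k) (d k)"
  using iteration[of k] by (simp add: trfd_iteration_def)

lemma success:
  assumes "step3 k" "\<alpha> \<le> \<rho> k"
  shows "X (Suc k) = X k + d k" "\<Delta> (Suc k) = min (2 * \<Delta> k) \<Delta>max" "\<tau> (Suc k) = \<tau> k"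
    "at_step1 (S (Suc k))"
  using iteration[of k] assms by (auto simp: trfd_iteration_def)

lemma failure:
  assumes "step3 k" "\<rho> k < \<alpha>"
  shows "X (Suc k) = X k" "\<Delta> (Suc k) = \<Delta> k / 2"
    "\<tau> k * sqrt n \<le> \<Delta> (Suc k) \<Longrightarrow> \<tau> (Suc k) = \<tau> k \<and> A (Suc k) = A k \<and> \<not> at_step1 (S (Suc k))"
    "\<Delta> (Suc k) < \<tau> k * sqrt n \<Longrightarrow> \<tau> (Suc k) = \<tau> k / 2 \<and> at_step1 (S (Suc k))"
proof -
  have *: "X (Suc k) = X k \<and> \<Delta> (Suc k) = \<Delta> k / 2 \<and>
      (if \<tau> k * sqrt n \<le> \<Delta> (Suc k)
       then \<tau> (Suc k) = \<tau> k \<and> A (Suc k) = A k \<and> \<not> at_step1 (S (Suc k))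
       else \<tau> (Suc k) = \<tau> k / 2 \<and> at_step1 (S (Suc k)))"
    using iteration[of k] assms unfolding trfd_iteration_def by (metis not_le)
  then show "X (Suc k) = X k" "\<Delta> (Suc k) = \<Delta> k / 2" by blast+
  show "\<tau> (Suc k) = \<tau> k \<and> A (Suc k) = A k \<and> \<not> at_step1 (S (Suc k))"
    if "\<tau> k * sqrt n \<le> \<Delta> (Suc k)"
    using * that by metis
  show "\<tau> (Suc k) = \<tau> k / 2 \<and> at_step1 (S (Suc k))" if "\<Delta> (Suc k) < \<tau> k * sqrt n"
    using * that by (metis not_le)
qed

text \<open>The loop invariant. Two clauses serve the iterations that begin at Step 3: the stored
  matrix is still a difference matrix for the current point and step, and it has already passed the
  test of Step 2.\<close>

definition "valid k \<longleftrightarrow> X k \<in> \<Omega> \<and> 0 < \<tau> k \<and> \<tau> k * sqrt n \<le> \<Delta> k \<and> \<Delta> k \<le> \<Delta>max \<and>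
  \<kappa> * \<epsilon> \<le> \<Delta> k \<and> finite_difference_model n m F (X k) (\<tau> k) (A k) \<and>
  (\<not> at_step1 (S k) \<longrightarrow> \<epsilon> / 2 \<le> \<eta> \<Delta>max (X k) (A k))"

lemma validD:
  assumes "valid k"
  shows "X k \<in> \<Omega>" "0 < \<tau> k" "\<tau> k * sqrt n \<le> \<Delta> k" "\<Delta> k \<le> \<Delta>max" "\<kappa> * \<epsilon> \<le> \<Delta> k" "0 < \<Delta> k"
    "finite_difference_model n m F (X k) (\<tau> k) (A k)" "A k \<in> carrier_mat m n"
proof -
  have "0 < \<kappa> * \<epsilon>" using \<kappa>_pos \<epsilon> by simp
  then show "X k \<in> \<Omega>" "0 < \<tau> k" "\<tau> k * sqrt n \<le> \<Delta> k" "\<Delta> k \<le> \<Delta>max" "\<kappa> * \<epsilon> \<le> \<Delta> k" "0 < \<Delta> k"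
    "finite_difference_model n m F (X k) (\<tau> k) (A k)" "A k \<in> carrier_mat m n"
    using assms by (auto simp: valid_def finite_difference_model_def)
qed

lemma step3_eta_ge:
  assumes "valid k" "step3 k"
  shows "\<epsilon> / 2 \<le> \<eta> \<Delta>max (X k) (A k)"
  using assms by (auto simp: valid_def reaches_step3_def)

text \<open>An instance of \<open>model_decrease\<close>: the trust region of radius
  \<open>\<Delta> k\<close> lies within the ball of radius \<open>\<Delta>max\<close>, over which
  Step 2 has measured at least \<epsilon>/2.\<close>

lemma predicted_decrease:
  assumes v: "valid k" and s3: "step3 k"
  shows "\<theta> * \<Delta> k * \<epsilon> / 2 \<le> h (F (X k)) - h (F (X k) + A k *\<^sub>v d k)"
proof -
  note vD = validD[OF v]
  have "\<theta> * \<Delta> k * (\<epsilon> / 2) \<le> \<theta> * \<Delta> k * \<eta> \<Delta>max (X k) (A k)"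
    using step3_eta_ge[OF v s3] \<theta> vD by (intro mult_left_mono) auto
  also have "\<dots> \<le> h (F (X k)) - h (F (X k) + A k *\<^sub>v d k)"
    using \<theta> vD by (intro model_decrease trial_acceptable s3) auto
  finally show ?thesis by simp
qed

text \<open>With a positive denominator of the ratio, acceptance and rejection become inequalities
  between actual and predicted decrease.\<close>

lemma predicted_decrease_pos:
  assumes "valid k" "step3 k"
  shows "0 < h (F (X k)) - h (F (X k) + A k *\<^sub>v d k)"
proof -
  have "0 < \<theta> * \<Delta> k * \<epsilon> / 2"
    using \<theta> \<epsilon> validD(6)[OF assms(1)] by simp
  also note predicted_decrease[OF assms]
  finally show ?thesis .
qed

lemma trial_step:
  assumes "step3 k"
  shows "d k \<in> carrier_vec n" "X k + d k \<in> \<Omega>" "pnorm 2 (d k) \<le> \<Delta> k"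
  using trial_acceptable[OF assms] stepsD[of "d k" "\<Delta> k" "X k"] by (auto simp: acceptable_trial_def)

lemma success_decrease:
  assumes v: "valid k" and s3: "step3 k" and succ: "\<alpha> \<le> \<rho> k"
  shows "h (F (X (Suc k))) \<le> h (F (X k)) - \<alpha> * \<theta> * \<kappa> * \<epsilon>\<^sup>2 / 2"
proof -
  note vD = validD[OF v]
  let ?pred = "h (F (X k)) - h (F (X k) + A k *\<^sub>v d k)"
  have "\<alpha> * ?pred \<le> h (F (X k)) - h (F (X (Suc k)))"
    using succ predicted_decrease_pos[OF v s3] success(1)[OF s3 succ]
    by (simp add: reduction_ratio_def pos_le_divide_eq)
  moreover have "\<alpha> * (\<theta> * (\<kappa> * \<epsilon>) * \<epsilon> / 2) \<le> \<alpha> * (\<theta> * \<Delta> k * \<epsilon> / 2)"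
    using vD(5) \<alpha> \<theta> \<epsilon> by (intro mult_left_mono divide_right_mono mult_right_mono) auto
  moreover have "\<alpha> * (\<theta> * \<Delta> k * \<epsilon> / 2) \<le> \<alpha> * ?pred"
    using predicted_decrease[OF v s3] \<alpha> by (intro mult_left_mono) auto
  moreover have "\<alpha> * (\<theta> * (\<kappa> * \<epsilon>) * \<epsilon> / 2) = \<alpha> * \<theta> * \<kappa> * \<epsilon>\<^sup>2 / 2"
    by (simp add: power2_eq_square)
  ultimately show ?thesis by linarith
qed

text \<open>Rejection leaves a gap of more than 1 - \<alpha> times the predicted decrease between
  the true and the model value at the trial point. The gap is at most quadratic in the radius and
  the predicted decrease at least linear, so the radius cannot be small.\<close>

lemma failure_radius:
  assumes v: "valid k" and s3: "step3 k" and fail: "\<rho> k < \<alpha>"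
  shows "2 * (\<kappa> * \<epsilon>) \<le> \<Delta> k"
proof -
  note vD = validD[OF v]
  let ?pred = "h (F (X k)) - h (F (X k) + A k *\<^sub>v d k)"
  have "h (F (X k)) - h (F (X k + d k)) < \<alpha> * ?pred"
    using fail predicted_decrease_pos[OF v s3] by (simp add: reduction_ratio_def pos_divide_less_eq)
  moreover have "h (F (X k + d k)) - h (F (X k) + A k *\<^sub>v d k) \<le> 2 * K * L * (\<Delta> k)\<^sup>2"
    using vD trial_step[OF s3] \<Omega>_carrier by (intro model_error_at_step[where \<tau> = "\<tau> k"]) auto
  moreover have "(1 - \<alpha>) * (\<theta> * \<Delta> k * \<epsilon> / 2) \<le> (1 - \<alpha>) * ?pred"
    using predicted_decrease[OF v s3] \<alpha> by (intro mult_left_mono) auto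
  moreover have "(1 - \<alpha>) * ?pred = ?pred - \<alpha> * ?pred"
    by (simp add: left_diff_distrib)
  ultimately have "(1 - \<alpha>) * (\<theta> * \<Delta> k * \<epsilon> / 2) \<le> 2 * K * L * (\<Delta> k)\<^sup>2"
    by linarith
  then have "\<Delta> k * ((1 - \<alpha>) * \<theta> * \<epsilon> / 2) \<le> \<Delta> k * (2 * K * L * \<Delta> k)"
    by (simp add: power2_eq_square mult_ac)
  then have "(1 - \<alpha>) * \<theta> * \<epsilon> / 2 \<le> 2 * K * L * \<Delta> k"
    using vD(6) by (subst (asm) mult_le_cancel_left_pos)
  then have "2 * ((1 - \<alpha>) * \<theta> / (8 * K * L) * \<epsilon>) \<le> \<Delta> k"
    using K_pos L_pos by (simp add: field_simps)
  moreover have "\<kappa> * \<epsilon> \<le> (1 - \<alpha>) * \<theta> / (8 * K * L) * \<epsilon>"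
    using \<epsilon> by (intro mult_right_mono) (auto simp: \<kappa>_def)
  ultimately show ?thesis by linarith
qed

lemma validI:
  assumes "X k \<in> \<Omega>" "0 < \<tau> k" "\<tau> k * sqrt n \<le> \<Delta> k" "\<Delta> k \<le> \<Delta>max" "\<kappa> * \<epsilon> \<le> \<Delta> k"
    and "at_step1 (S k)"
  shows "valid k"
  using assms step1_model[of k] by (simp add: valid_def)

lemma valid_all: "valid k"
proof (induction k)
  case 0
  have "\<kappa> * \<epsilon> \<le> \<Delta>\<^sub>0 * 1" using \<epsilon> \<Delta>\<^sub>0 by (intro mult_mono) (auto simp: \<kappa>_def)
  then show ?case
    using x\<^sub>0 \<tau>\<^sub>0 initial_state by (intro validI) simp_all
next
  case (Suc k)
  note vD = validD[OF Suc]
  consider "\<not> step3 k" | "step3 k" "\<alpha> \<le> \<rho> k" | "step3 k" "\<rho> k < \<alpha>" by linarith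
  then show ?case
  proof cases
    case 1
    have "\<tau> k / 2 * sqrt n \<le> \<tau> k * sqrt n" using vD(2) by (intro mult_right_mono) auto
    then have "\<tau> k / 2 * sqrt n \<le> \<Delta> k" using vD(3) by linarith
    then show ?thesis
      using vD(1,2,4,5) refinement(4)[OF 1] by (intro validI) (simp_all add: refinement(1-3)[OF 1])
  next
    case 2
    have "\<Delta> k \<le> \<Delta> (Suc k)" "\<Delta> (Suc k) \<le> \<Delta>max" using success(2)[OF 2] vD(4,6) by auto
    then show ?thesis
      using vD(2,3,5) success(4)[OF 2] trial_step(2)[OF 2(1)]
      by (intro validI) (simp_all add: success(1,3)[OF 2])
  next
    case 3
    have \<Delta>: "\<kappa> * \<epsilon> \<le> \<Delta> (Suc k)" "\<Delta> (Suc k) \<le> \<Delta>max"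
      using failure_radius[OF Suc 3] failure(2)[OF 3] vD(4,6) by auto
    show ?thesis
    proof (cases "\<tau> k * sqrt n \<le> \<Delta> (Suc k)")
      case True
      \<comment> \<open>Point, difference step and matrix are all carried over, so the model stays
        correct without reconstruction and keeps its bound on \<open>\<eta>\<close>.\<close>
      note fail = failure(1)[OF 3] failure(3)[OF 3 True]
      show ?thesis
        unfolding valid_def using vD(1,2,7) \<Delta> True fail step3_eta_ge[OF Suc 3(1)] by simp
    next
      case False
      then have fail: "\<tau> (Suc k) = \<tau> k / 2" "at_step1 (S (Suc k))"
        using failure(4)[OF 3] by auto
      \<comment> \<open>Difference step and radius are halved together, which preserves their
        inequality.\<close>
      have "\<tau> k / 2 * sqrt n \<le> \<Delta> (Suc k)"
        using vD(3) failure(2)[OF 3] by simp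
      then show ?thesis
        using vD(1,2) \<Delta> fail(2) by (intro validI) (simp_all add: failure(1)[OF 3] fail(1))
    qed
  qed
qed

text \<open>
  A successful iteration lowers the first summand by at least \<open>2\<close> and raises the second by at most
  \<open>1\<close>; an unsuccessful one lowers the second by \<open>1\<close>. An iteration that only refines the
  finite-difference step lowers the third summand by \<open>1\<close>: at a nonstationary point it can occur
  only when \<open>2 K L \<surd>n \<tau> > \<epsilon>\<close>.
\<close>

definition potential :: "nat \<Rightarrow> real" where
  "potential k = 2 * (h (F (X k)) - f_low) / (\<alpha> * \<theta> * \<kappa> * \<epsilon>\<^sup>2 / 2) + log 2 (\<Delta> k / (\<kappa> * \<epsilon>)) +
     max 0 (log 2 (4 * K * L * sqrt n * \<tau> k / \<epsilon>))"

lemma potential_nonneg: "0 \<le> potential k"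
proof -
  note vD = validD[OF valid_all[of k]]
  have "0 \<le> log 2 (\<Delta> k / (\<kappa> * \<epsilon>))"
    using vD(5) \<kappa>_pos \<epsilon> by (subst zero_le_log_cancel_iff) (auto simp: pos_le_divide_eq intro!: divide_pos_pos vD)
  moreover have "0 \<le> 2 * (h (F (X k)) - f_low) / (\<alpha> * \<theta> * \<kappa> * \<epsilon>\<^sup>2 / 2)"
    using f_low[OF \<Omega>_carrier[OF vD(1)]] \<alpha> \<theta> \<kappa>_pos \<epsilon> by (intro divide_nonneg_pos) auto
  ultimately show ?thesis by (simp add: potential_def)
qed

lemma potential_decreases:
  assumes nonstationary: "\<epsilon> < \<psi> \<Delta>max (X k)"
  shows "potential (Suc k) \<le> potential k - 1"
proof -
  note vD = validD[OF valid_all[of k]] and vD' = validD[OF valid_all[of "Suc k"]]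
  define D where "D = \<alpha> * \<theta> * \<kappa> * \<epsilon>\<^sup>2 / 2"
  have D: "0 < D" using \<alpha> \<theta> \<kappa>_pos \<epsilon> by (simp add: D_def)
  have \<kappa>\<epsilon>: "0 < \<kappa> * \<epsilon>" using \<kappa>_pos \<epsilon> by simp
  define c where "c = 4 * K * L * sqrt n / \<epsilon>"
  have c: "0 < c" using K_pos L_pos n_pos \<epsilon> by (simp add: c_def)
  have pot: "potential j = 2 * (h (F (X j)) - f_low) / D + log 2 (\<Delta> j / (\<kappa> * \<epsilon>)) + max 0 (log 2 (c * \<tau> j))" for j
    by (simp add: potential_def D_def c_def)
  have half: "log 2 (y / 2) = log 2 y - 1" if "0 < y" for y
    using that by (simp add: log_divide)
  consider "\<not> step3 k" | "step3 k" "\<alpha> \<le> \<rho> k" | "step3 k" "\<rho> k < \<alpha>" by linarith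
  then show ?thesis
  proof cases
    case 1
    then have "\<eta> \<Delta>max (X k) (A k) < \<epsilon> / 2" by (auto simp: reaches_step3_def)
    \<comment> \<open>The measure exceeds \<epsilon> while its estimate is below \<epsilon>/2, so
      the finite-difference error must supply more than \<epsilon>/2.\<close>
    with psi_le_eta[OF vD(1,2,7), of \<Delta>max] nonstationary vD(4,6)
    have "\<epsilon> / 2 < K * L * sqrt n * \<tau> k" by linarith
    \<comment> \<open>The factor 4 in \<open>c\<close> gives 2 here and not 1: the logarithm stays
      positive after the halving, so the truncation at 0 does not diminish the drop.\<close>
    then have "2 < c * \<tau> k" using \<epsilon> by (simp add: c_def field_simps)
    then have "1 < log 2 (c * \<tau> k)" by (subst less_log_iff) auto
    moreover have "c * \<tau> (Suc k) = c * \<tau> k / 2"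
      using refinement(3)[OF 1] by simp
    then have "log 2 (c * \<tau> (Suc k)) = log 2 (c * \<tau> k) - 1"
      using half[of "c * \<tau> k"] c vD(2) by (metis mult_pos_pos)
    ultimately show ?thesis
      unfolding pot using refinement(1,2)[OF 1] by simp
  next
    case 2
    have "2 * (h (F (X (Suc k))) - f_low) / D \<le> 2 * (h (F (X k)) - f_low - D) / D"
      using success_decrease[OF valid_all 2] D by (intro divide_right_mono) (auto simp: D_def)
    also have "\<dots> = 2 * (h (F (X k)) - f_low) / D - 2"
      using D by (simp add: field_simps)
    finally have "2 * (h (F (X (Suc k))) - f_low) / D \<le> 2 * (h (F (X k)) - f_low) / D - 2" .
    moreover have "log 2 (\<Delta> (Suc k) / (\<kappa> * \<epsilon>)) \<le> log 2 (2 * (\<Delta> k / (\<kappa> * \<epsilon>)))"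
      using success(2)[OF 2] \<kappa>\<epsilon> vD(6) vD'(6)
      by (subst log_le_cancel_iff) (auto intro!: divide_right_mono divide_pos_pos)
    moreover have "log 2 (2 * (\<Delta> k / (\<kappa> * \<epsilon>))) = 1 + log 2 (\<Delta> k / (\<kappa> * \<epsilon>))"
      using divide_pos_pos[OF vD(6) \<kappa>\<epsilon>] by (subst log_mult) auto
    ultimately show ?thesis
      unfolding pot success(3)[OF 2] by linarith
  next
    case 3
    have "\<Delta> (Suc k) / (\<kappa> * \<epsilon>) = \<Delta> k / (\<kappa> * \<epsilon>) / 2"
      unfolding failure(2)[OF 3] by simp
    then have "log 2 (\<Delta> (Suc k) / (\<kappa> * \<epsilon>)) = log 2 (\<Delta> k / (\<kappa> * \<epsilon>)) - 1"
      by (simp only: half[OF divide_pos_pos[OF vD(6) \<kappa>\<epsilon>]])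
    \<comment> \<open>The third summand cannot offset the drop of the second, since rejection never
      enlarges the difference step.\<close>
    moreover have "\<tau> (Suc k) \<le> \<tau> k"
      using failure(3,4)[OF 3] vD(2) by (cases "\<tau> k * sqrt n \<le> \<Delta> (Suc k)") auto
    then have "log 2 (c * \<tau> (Suc k)) \<le> log 2 (c * \<tau> k)"
      using c vD(2) vD'(2) by (subst log_le_cancel_iff) auto
    ultimately show ?thesis
      unfolding pot failure(1)[OF 3] by linarith
  qed
qed

section \<open>From the potential to the evaluation count\<close>

lemma nonstationary_iterations_le_potential:
  assumes "\<And>j. j < k \<Longrightarrow> \<epsilon> < \<psi> \<Delta>max (X j)"
  shows "real k \<le> potential 0"
proof -
  have "potential k \<le> potential 0 - real k"
    using assms
  proof (induction k)
    case (Suc k)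
    then show ?case using potential_decreases[of k] by fastforce
  qed simp
  then show ?thesis using potential_nonneg[of k] by linarith
qed

lemma evaluations_le: "evaluations n p h F \<Omega> \<epsilon> \<Delta>max S k \<le> 1 + k * (n + 1)"
proof -
  have "(\<Sum>j<k. (if at_step1 (S j) then n else 0) + (if step3 j then 1 else 0)) \<le> (\<Sum>j<k. n + 1)"
    by (intro sum_mono) auto
  then show ?thesis by (simp add: evaluations_def)
qed

text \<open>Were every iterate nonstationary, all natural numbers would lie below the initial
  potential. The same bound then applies to the least stationary index, where counting
  stops.\<close>

lemma first_stationary_iterate:
  "\<exists>k. \<psi> \<Delta>max (X k) \<le> \<epsilon> \<and> (\<forall>j<k. \<not> \<psi> \<Delta>max (X j) \<le> \<epsilon>) \<and>
    real (evaluations n p h F \<Omega> \<epsilon> \<Delta>max S k) \<le> (1 + 2 * potential 0) * n"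
proof -
  have ex: "\<exists>k. \<psi> \<Delta>max (X k) \<le> \<epsilon>"
  proof (rule ccontr)
    assume "\<not> ?thesis"
    then have "real k \<le> potential 0" for k
      by (intro nonstationary_iterations_le_potential) (simp add: not_le)
    then show False using reals_Archimedean2[of "potential 0"] by (meson not_le)
  qed
  define k where "k = (LEAST k. \<psi> \<Delta>max (X k) \<le> \<epsilon>)"
  have first: "\<psi> \<Delta>max (X k) \<le> \<epsilon>" "\<And>j. j < k \<Longrightarrow> \<not> \<psi> \<Delta>max (X j) \<le> \<epsilon>"
    unfolding k_def by (rule LeastI_ex[OF ex], rule not_less_Least)
  have "real k \<le> potential 0"
    using first(2) by (intro nonstationary_iterations_le_potential) (simp add: not_le)
  moreover have "real (evaluations n p h F \<Omega> \<epsilon> \<Delta>max S k) \<le> 1 + real k * (real n + 1)"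
    using of_nat_mono[OF evaluations_le[of k], where ?'a = real] by (simp add: algebra_simps)
  \<comment> \<open>Here n \<ge> 1 absorbs the evaluation at the start and the one per trial point
    into multiples of n.\<close>
  moreover have "1 + real k * (real n + 1) \<le> real n + real k * (2 * real n)"
    using n_pos by (intro add_mono mult_left_mono) auto
  moreover have "real k * (2 * real n) \<le> potential 0 * (2 * real n)"
    using \<open>real k \<le> potential 0\<close> by (intro mult_right_mono) auto
  ultimately have "real (evaluations n p h F \<Omega> \<epsilon> \<Delta>max S k) \<le> (1 + 2 * potential 0) * n"
    unfolding distrib_right by linarith
  with first show ?thesis by blast
qed

text \<open>The choice of \<open>\<tau>\<^sub>0\<close> cancels K, sqrt n and \<epsilon> in the
  third summand and leaves a constant. The first summand is of order 1/\<epsilon>^2 already, and the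
  second grows only logarithmically in 1/\<epsilon>, so crude bounds suffice.\<close>

lemma potential_0_le:
  assumes \<sigma>: "0 < \<sigma>" and \<tau>\<^sub>0_eq: "\<tau>\<^sub>0 = \<epsilon> / (K * \<sigma> * sqrt n)" and M: "h (F x\<^sub>0) - f_low \<le> M"
  shows "potential 0 \<le> (4 * M / (\<alpha> * \<theta> * \<kappa>) + 2 * \<Delta>\<^sub>0 / \<kappa> + max 0 (log 2 (4 * L / \<sigma>))) / \<epsilon>\<^sup>2"
proof -
  have \<epsilon>2: "0 < \<epsilon>\<^sup>2" "\<epsilon>\<^sup>2 \<le> \<epsilon>" "\<epsilon>\<^sup>2 \<le> 1"
    using \<epsilon> by (auto simp: power2_eq_square mult_le_one)
  have "2 * (h (F x\<^sub>0) - f_low) / (\<alpha> * \<theta> * \<kappa> * \<epsilon>\<^sup>2 / 2) \<le> 2 * M / (\<alpha> * \<theta> * \<kappa> * \<epsilon>\<^sup>2 / 2)"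
    using M \<alpha> \<theta> \<kappa>_pos \<epsilon>2 by (intro divide_right_mono) auto
  moreover have "log 2 (\<Delta>\<^sub>0 / (\<kappa> * \<epsilon>)) \<le> 2 * \<Delta>\<^sub>0 / \<kappa> / \<epsilon>\<^sup>2"
  proof -
    define y where "y = \<Delta>\<^sub>0 / (\<kappa> * \<epsilon>)"
    have y: "0 < y" using \<Delta>\<^sub>0 \<kappa>_pos \<epsilon> by (simp add: y_def)
    \<comment> \<open>The inequality ln t \<le> t - 1 at t = 1/2; it turns the binary logarithm of y
      into at most 2 y.\<close>
    have "1 / 2 \<le> ln (2 :: real)"
      using ln_le_minus_one[of "1 / 2 :: real"] by (simp add: ln_div)
    have "log 2 y = ln y / ln 2" by (simp add: log_def)
    also have "\<dots> \<le> y / ln 2" using ln_le_minus_one[OF y] by (intro divide_right_mono) auto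
    also have "\<dots> \<le> y / (1 / 2)"
      using y \<open>1 / 2 \<le> ln 2\<close> by (intro divide_left_mono) auto
    also have "\<dots> = 2 * \<Delta>\<^sub>0 / \<kappa> / \<epsilon>" by (simp add: y_def)
    also have "\<dots> \<le> 2 * \<Delta>\<^sub>0 / \<kappa> / \<epsilon>\<^sup>2"
      using \<Delta>\<^sub>0 \<kappa>_pos by (intro divide_left_mono mult_pos_pos \<epsilon> \<epsilon>2) auto
    finally show ?thesis by (simp add: y_def)
  qed
  moreover have "4 * K * L * sqrt n * \<tau>\<^sub>0 / \<epsilon> = 4 * L / \<sigma>"
    unfolding \<tau>\<^sub>0_eq using K_pos n_pos \<epsilon> \<sigma> by (simp add: field_simps)
  moreover have "max 0 (log 2 (4 * L / \<sigma>)) \<le> max 0 (log 2 (4 * L / \<sigma>)) / \<epsilon>\<^sup>2"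
    by (subst pos_le_divide_eq[OF \<epsilon>2(1)], rule mult_left_le[OF \<epsilon>2(3)]) simp
  ultimately show ?thesis
    unfolding potential_def initial_state by (simp add: add_divide_distrib mult_ac)
qed

end

section \<open>The L1 and minimax problems\<close>

text \<open>The reverse triangle inequality in the 1-norm, followed by Cauchy-Schwarz against the
  all-ones vector. The factor sqrt m is L_{h,p} c_{p,2}(m) for both values of p.\<close>

lemma pnorm_1_lipschitz:
  assumes "z \<in> carrier_vec m" "w \<in> carrier_vec m"
  shows "\<bar>pnorm 1 z - pnorm 1 w\<bar> \<le> sqrt m * pnorm 2 (z - w)"
  using pnorm_1_reverse_triangle[of z w] pnorm_1_le_pnorm_2[of "z - w"] assms by simp

lemma pnorm_1_convex:
  assumes "z \<in> carrier_vec m" "w \<in> carrier_vec m" "0 \<le> t" "t \<le> 1"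
  shows "pnorm 1 ((1 - t) \<cdot>\<^sub>v z + t \<cdot>\<^sub>v w) \<le> (1 - t) * pnorm 1 z + t * pnorm 1 w"
proof -
  have "pnorm 1 ((1 - t) \<cdot>\<^sub>v z + t \<cdot>\<^sub>v w) = (\<Sum>i<m. \<bar>(1 - t) * z $ i + t * w $ i\<bar>)"
    unfolding pnorm_1_eq using assms by (intro sum.cong) auto
  also have "\<dots> \<le> (\<Sum>i<m. (1 - t) * \<bar>z $ i\<bar> + t * \<bar>w $ i\<bar>)"
    using assms(3,4) by (intro sum_mono order.trans[OF abs_triangle_ineq]) (simp add: abs_mult)
  also have "\<dots> = (1 - t) * pnorm 1 z + t * pnorm 1 w"
    unfolding pnorm_1_eq using assms by (simp add: sum.distrib sum_distrib_left)
  finally show ?thesis .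
qed

text \<open>Describing the maximum by its upper bounds reduces the Lipschitz and convexity claims to
  single entries; 0 < m keeps \<open>Max\<close> away from the empty set.\<close>

lemma max_entry_le_iff:
  assumes "z \<in> carrier_vec m" "0 < m"
  shows "max_entry z \<le> c \<longleftrightarrow> (\<forall>i<m. z $ i \<le> c)"
proof -
  have "{z $ i | i. i < dim_vec z} = (\<lambda>i. z $ i) ` {..<m}" using assms(1) by auto
  moreover have "{..<m} \<noteq> {}" using assms(2) by auto
  ultimately show ?thesis by (auto simp: max_entry_def)
qed

lemma index_le_max_entry: "z \<in> carrier_vec m \<Longrightarrow> i < m \<Longrightarrow> z $ i \<le> max_entry z"
  using max_entry_le_iff[of z m "max_entry z"] by auto

lemma max_entry_lipschitz:
  assumes "z \<in> carrier_vec m" "w \<in> carrier_vec m" "0 < m"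
  shows "\<bar>max_entry z - max_entry w\<bar> \<le> pnorm 2 (z - w)"
proof -
  have diff: "\<bar>z $ i - w $ i\<bar> \<le> pnorm 2 (z - w)" if "i < m" for i
    using abs_index_le_pnorm_2[of i "z - w"] assms that by simp
  have "max_entry z \<le> max_entry w + pnorm 2 (z - w)"
    unfolding max_entry_le_iff[OF assms(1,3)]
  proof (intro allI impI)
    fix i assume "i < m"
    then show "z $ i \<le> max_entry w + pnorm 2 (z - w)"
      using diff[of i] index_le_max_entry[OF assms(2), of i] by linarith
  qed
  moreover have "max_entry w \<le> max_entry z + pnorm 2 (z - w)"
    unfolding max_entry_le_iff[OF assms(2,3)]
  proof (intro allI impI)
    fix i assume "i < m"
    then show "w $ i \<le> max_entry z + pnorm 2 (z - w)"
      using diff[of i] index_le_max_entry[OF assms(1), of i] by linarith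
  qed
  ultimately show ?thesis by linarith
qed

lemma max_entry_convex:
  assumes "z \<in> carrier_vec m" "w \<in> carrier_vec m" "0 < m" "0 \<le> t" "t \<le> 1"
  shows "max_entry ((1 - t) \<cdot>\<^sub>v z + t \<cdot>\<^sub>v w) \<le> (1 - t) * max_entry z + t * max_entry w"
proof -
  have c: "(1 - t) \<cdot>\<^sub>v z + t \<cdot>\<^sub>v w \<in> carrier_vec m" using assms by simp
  show ?thesis
    unfolding max_entry_le_iff[OF c assms(3)]
    using assms index_le_max_entry by (auto intro!: add_mono mult_left_mono)
qed

theorem mainTheorem3:
  fixes p m :: nat and h :: "real vec \<Rightarrow> real"
    and Lh cp2 :: real and c2p :: "nat \<Rightarrow> real"
    and L\<^sub>J \<sigma> \<alpha> \<theta> \<Delta>\<^sub>0 M :: real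
  assumes p: "p \<in> {1, 2}"
    and h: "h = pnorm 1 \<and> Lh = (if p = 1 then 1 else sqrt m) \<or> h = max_entry \<and> Lh = 1"
    and cp2: "cp2 = (if p = 1 then sqrt m else 1)"
    and c2p: "\<And>n. c2p n = 1"
    and "m \<ge> 1" and "L\<^sub>J > 0" and "\<sigma> > 0" and "0 < \<alpha>" "\<alpha> < 1" and "0 < \<theta>" "\<theta> \<le> 1"
    and "\<Delta>\<^sub>0 > 0" and "M \<ge> 0"
  shows "\<exists>C::real. \<forall>(n::nat) (\<epsilon>::real) (\<Omega>::real vec set) (F::real vec \<Rightarrow> real vec)
            (f_low::real) (x\<^sub>0::real vec) (\<Delta>max::real) (S::nat \<Rightarrow> trfd_state).
      n \<ge> 1 \<longrightarrow> 0 < \<epsilon> \<longrightarrow> \<epsilon> \<le> 1 \<longrightarrow>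
      \<Omega> \<subseteq> carrier_vec n \<longrightarrow> \<Omega> \<noteq> {} \<longrightarrow> closed_vec_set n \<Omega> \<longrightarrow> convex_vec_set \<Omega> \<longrightarrow>
      F \<in> carrier_vec n \<rightarrow> carrier_vec m \<longrightarrow>
      (\<forall>x\<in>carrier_vec n. differentiable_at_vec n m F x) \<longrightarrow>
      (\<forall>x\<in>carrier_vec n. \<forall>y\<in>carrier_vec n.
         spectral_norm (jacobian_mat n m F x - jacobian_mat n m F y) \<le> L\<^sub>J * pnorm 2 (x - y)) \<longrightarrow>
      (\<forall>x\<in>carrier_vec n. f_low \<le> h (F x)) \<longrightarrow>
      x\<^sub>0 \<in> \<Omega> \<longrightarrow> h (F x\<^sub>0) - f_low \<le> M \<longrightarrow>
      trfd_run n m p h F \<Omega> x\<^sub>0 \<epsilon> \<alpha> \<theta> (tau_init n Lh cp2 (c2p n) \<sigma> \<epsilon>) \<Delta>\<^sub>0 \<Delta>max S \<longrightarrow>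
      (\<exists>k. psi n m p h F \<Omega> \<Delta>max (iterate (S k)) \<le> \<epsilon> \<and>
           (\<forall>j<k. \<not> psi n m p h F \<Omega> \<Delta>max (iterate (S j)) \<le> \<epsilon>) \<and>
           real (evaluations n p h F \<Omega> \<epsilon> \<Delta>max S k) \<le> C * real n * \<epsilon> powi (-2))"
proof -
  define K where "K = Lh * cp2"
  have K_pos: "0 < K" using h cp2 \<open>m \<ge> 1\<close> by (auto simp: K_def)
  have h_lipschitz: "\<bar>h z - h w\<bar> \<le> K * pnorm 2 (z - w)"
    if zw: "z \<in> carrier_vec m" "w \<in> carrier_vec m" for z w
    using h
  proof
    assume "h = pnorm 1 \<and> Lh = (if p = 1 then 1 else sqrt m)"
    then show ?thesis using pnorm_1_lipschitz[OF zw] by (auto simp: K_def cp2)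
  next
    assume hm: "h = max_entry \<and> Lh = 1"
    \<comment> \<open>The maximum is 1-Lipschitz, whereas K is sqrt m when p = 1; m \<ge> 1 gives 1
      \<le> K.\<close>
    have "1 * pnorm 2 (z - w) \<le> K * pnorm 2 (z - w)"
      using hm \<open>m \<ge> 1\<close> by (intro mult_right_mono) (auto simp: K_def cp2)
    then show ?thesis using hm max_entry_lipschitz[OF zw] \<open>m \<ge> 1\<close> by auto
  qed
  have h_convex: "h ((1 - t) \<cdot>\<^sub>v z + t \<cdot>\<^sub>v w) \<le> (1 - t) * h z + t * h w"
    if "z \<in> carrier_vec m" "w \<in> carrier_vec m" "0 \<le> t" "t \<le> 1" for z w t
    using h pnorm_1_convex[OF that] max_entry_convex[OF that(1,2) _ that(3,4)] \<open>m \<ge> 1\<close> by auto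
  \<comment> \<open>These repeat \<open>\<kappa>\<close> and the numerator in
    \<open>potential_0_le\<close> before n, \<epsilon>, \<Omega> and F are fixed, so the final
    constant depends on none of them.\<close>
  define \<kappa>\<^sub>0 where "\<kappa>\<^sub>0 = min \<Delta>\<^sub>0 ((1 - \<alpha>) * \<theta> / (8 * K * L\<^sub>J))"
  define B where "B = 4 * M / (\<alpha> * \<theta> * \<kappa>\<^sub>0) + 2 * \<Delta>\<^sub>0 / \<kappa>\<^sub>0 + max 0 (log 2 (4 * L\<^sub>J / \<sigma>))"
  show ?thesis
  \<comment> \<open>The witness combines the count (1 + 2 \<open>potential 0\<close>) n with
    \<open>potential 0\<close> \<le> B/\<epsilon>^2 and 1 \<le> 1/\<epsilon>^2.\<close>
  proof (rule exI[of _ "1 + 2 * B"], intro allI impI)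
    fix n \<epsilon> \<Omega> F f_low x\<^sub>0 \<Delta>max S
    let ?\<tau>\<^sub>0 = "tau_init n Lh cp2 (c2p n) \<sigma> \<epsilon>"
    assume n: "n \<ge> (1::nat)" and \<epsilon>: "0 < \<epsilon>" "\<epsilon> \<le> 1"
      and \<Omega>: "\<Omega> \<subseteq> carrier_vec n" "closed_vec_set n \<Omega>" "convex_vec_set \<Omega>"
      and F: "F \<in> carrier_vec n \<rightarrow> carrier_vec m"
        "\<forall>x\<in>carrier_vec n. differentiable_at_vec n m F x"
        "\<forall>x\<in>carrier_vec n. \<forall>y\<in>carrier_vec n.
          spectral_norm (jacobian_mat n m F x - jacobian_mat n m F y) \<le> L\<^sub>J * pnorm 2 (x - y)"
      and f_low: "\<forall>x\<in>carrier_vec n. f_low \<le> h (F x)"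
      and x\<^sub>0: "x\<^sub>0 \<in> \<Omega>" and M: "h (F x\<^sub>0) - f_low \<le> M"
      and run: "trfd_run n m p h F \<Omega> x\<^sub>0 \<epsilon> \<alpha> \<theta> ?\<tau>\<^sub>0 \<Delta>\<^sub>0 \<Delta>max S"
    have tau_eq: "?\<tau>\<^sub>0 = \<epsilon> / (K * \<sigma> * sqrt n)"
      by (simp add: tau_init_def K_def c2p mult_ac)
    have \<tau>\<^sub>0_pos: "0 < ?\<tau>\<^sub>0"
      unfolding tau_eq using \<epsilon> K_pos \<open>\<sigma> > 0\<close> n by simp
    interpret trfd_execution n m F L\<^sub>J p h K \<Omega> \<epsilon> \<alpha> \<theta> ?\<tau>\<^sub>0 \<Delta>\<^sub>0 \<Delta>max f_low x\<^sub>0 S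
      by unfold_locales
        (use assms n \<epsilon> \<Omega> F f_low x\<^sub>0 run \<tau>\<^sub>0_pos K_pos h_lipschitz h_convex in auto)
    obtain k where k: "\<psi> \<Delta>max (X k) \<le> \<epsilon>" "\<forall>j<k. \<not> \<psi> \<Delta>max (X j) \<le> \<epsilon>"
      "real (evaluations n p h F \<Omega> \<epsilon> \<Delta>max S k) \<le> (1 + 2 * potential 0) * n"
      using first_stationary_iterate by blast
    have "potential 0 \<le> B / \<epsilon>\<^sup>2"
      using potential_0_le[OF \<open>\<sigma> > 0\<close> tau_eq M] by (simp add: B_def \<kappa>\<^sub>0_def \<kappa>_def)
    moreover have "1 \<le> 1 / \<epsilon>\<^sup>2" using \<epsilon> by (simp add: power_le_one)
    ultimately have "1 + 2 * potential 0 \<le> (1 + 2 * B) / \<epsilon>\<^sup>2"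
      by (simp add: add_divide_distrib)
    then have "(1 + 2 * potential 0) * n \<le> (1 + 2 * B) / \<epsilon>\<^sup>2 * n"
      by (intro mult_right_mono) auto
    also have "\<dots> = (1 + 2 * B) * real n * \<epsilon> powi (-2)"
      by (simp add: power_int_minus divide_inverse mult_ac)
    finally have "real (evaluations n p h F \<Omega> \<epsilon> \<Delta>max S k) \<le> (1 + 2 * B) * real n * \<epsilon> powi (-2)"
      using k(3) by linarith
    with k(1,2) show "\<exists>k. psi n m p h F \<Omega> \<Delta>max (iterate (S k)) \<le> \<epsilon> \<and>
           (\<forall>j<k. \<not> psi n m p h F \<Omega> \<Delta>max (iterate (S j)) \<le> \<epsilon>) \<and>
           real (evaluations n p h F \<Omega> \<epsilon> \<Delta>max S k) \<le> (1 + 2 * B) * real n * \<epsilon> powi (-2)"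
      by blast
  qed
qed

end
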